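(* Let $1\le n\le r+1$ be integers and let $(p_1,\dots,p_n)$ and $(q_1,\dots,q_n)$ be two non-increasing sequences of non-negative integers with $p_1\le r+1-n$ and $q_1\le r+1-n$. The four following conditions are equivalent: 1. $\overline{C(p_1,\dots,p_n)}\cap C(q_1,\dots,q_n)\neq\emptyset$; 2. $q_i\ge p_i$ for all $i$; 3. there exists a system of arrows $S$ on $E(p_1,\dots,p_n)$ such that $S(E(p_1,\dots,p_n))=E(q_1,\dots,q_n)$; 4. there exists a system of arrows $S^{\nu}$ on $E(p_1,\dots,p_n)^{\nu}$ such that $S^{\nu}(E(p_1,\dots,p_n)^{\nu})=E(q_1,\dots,q_n)^{\nu}$.
   Context: Let $k$ be an algebraically closed field and take $(a,b)=(1,-1)$. Monomials $x^py^q\in k[x,y]$ are identified with couples $(p,q)\in\mathbb{N}^2$. Let $k[x,y]_r$ be the space of homogeneous polynomials of degree $r$ (usual degree), whose monomials are ordered by the exponent of $y$ (smaller exponent of $y$ means smaller monomial). Let $V_j$ be the span of the $j$ smallest monomials of degree $r$, and let $G(n,k[x,y]_r)$ be the Grassmannian of $n$-dimensional subspaces of $k[x,y]_r$. For a non-increasing sequence of non-negative integers $(p_1,\dots,p_n)$ with $p_1\le r+1-n$: - $E(p_1,\dots,p_n)$ is the staircase containing the monomials of degree at most $r-1$ and the monomials of degree $r$ not in $\{x^{n-i+p_i}y^{r-n+i-p_i},\ 1\le i\le n\}$, and no other monomials. - $C(p_1,\dots,p_n)\subset G(n,k[x,y]_r)$ is the Schubert cell of those $W$ such that $\dim(W\cap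 V_j)=i$ whenever $r+1-n+i-p_i\le j< r+1-n+(i+1)-p_{i+1}$ (for $i=0$ only the upper bound on $j$ is imposed, for $i=n$ only the lower bound). The closure is taken in $G(n,k[x,y]_r)$. A staircase is a subset of $\mathbb{N}^2$ whose complement is stable under addition of elements of $\mathbb{N}^2$. An arrow on a staircase $E$ is a couple $(P,Q)$ of monomials (origin $P$, end $Q$) with $P\in E$ and $\overrightarrow{PQ}=Q-P$ a negative multiple of $(a,b)=(1,-1)$, the zero multiple being allowed. An arrow $(P,Q)$ with $\overrightarrow{PQ}=\lambda(a,b)$ is shorter than $(P',Q')$ with $\overrightarrow{P'Q'}=\lambda'(a,b)$ if $|\lambda|\le|\lambda'|$. A system of arrows on $E$ is a set $S=\{(p,f_p):p\in E\}$ consisting of one arrow $(p,f_p)$ on $E$ for each $p\in E$, such that: (i) $p\neq q\Rightarrow f_p\neq f_q$; (ii) for every $f=(P,Q)\in S$ and every monomial $Q'$ dividing $Q$, there is $g\in S$ with end $Q'$ that is shorter than $f$. $S(E)$ denotes the set of ends of the arrows of $S$. Duals are taken in a fixed box $B_{M\times N}=\{(x,y)\in\mathbb{N}^2:x<M,\ y<N\}$ containing both staircases $E(p_1,\dots,p_n)$ and $E(q_1,\dots,q_n)$: for a staircase $E\subset B_{M\times N}$, $E^{\nu}=\{(x,y)\in B_{M\times N}:(M-1-x,\,N-1-y)\notin E\}$. *)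

theory Defs
  imports
    "HOL-Library.Poly_Mapping"
    "HOL-Library.Product_Plus"
    "HOL-Computational_Algebra.Polynomial"
    "HOL-Analysis.Abstract_Topology"
    "Jordan_Normal_Form.Determinant"
begin

text \<open>
  Staircases and arrows. The monomial \<open>x\<^sup>p y\<^sup>q\<close> is the couple \<open>(p, q)\<close>, so the product of
  monomials is the sum of couples.
\<close>

type_synonym monomial = "nat \<times> nat"

definition total_degree :: "monomial \<Rightarrow> nat" where
  "total_degree P = fst P + snd P"

definition mono_divides :: "monomial \<Rightarrow> monomial \<Rightarrow> bool" where
  "mono_divides P Q \<longleftrightarrow> (\<exists>R. Q = P + R)"

definition staircase :: "monomial set \<Rightarrow> bool" where
  "staircase E \<longleftrightarrow> (\<forall>P R. P \<notin> E \<longrightarrow> P + R \<notin> E)"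

text \<open>
  The vector from \<open>P\<close> to \<open>Q\<close> is \<open>l * (a, b)\<close> with \<open>(a, b) = (1, -1)\<close>. An integer \<open>l\<close> is no
  restriction, because \<open>l\<close> is the first coordinate of an integral vector.
\<close>

definition vec_multiple :: "monomial \<times> monomial \<Rightarrow> int \<Rightarrow> bool" where
  "vec_multiple f l \<longleftrightarrow>
     int (fst (snd f)) - int (fst (fst f)) = l * 1 \<and>
     int (snd (snd f)) - int (snd (fst f)) = l * (-1)"

definition arrow_on :: "monomial set \<Rightarrow> monomial \<times> monomial \<Rightarrow> bool" where
  "arrow_on E f \<longleftrightarrow> fst f \<in> E \<and> (\<exists>l\<le>0. vec_multiple f l)"

definition shorter :: "monomial \<times> monomial \<Rightarrow> monomial \<times> monomial \<Rightarrow> bool" where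
  "shorter f g \<longleftrightarrow> (\<exists>l m. vec_multiple f l \<and> vec_multiple g m \<and> \<bar>l\<bar> \<le> \<bar>m\<bar>)"

definition arrow_system :: "monomial set \<Rightarrow> (monomial \<times> monomial) set \<Rightarrow> bool" where
  "arrow_system E S \<longleftrightarrow>
     staircase E \<and>
     (\<exists>e. S = (\<lambda>P. (P, e P)) ` E \<and> (\<forall>P\<in>E. arrow_on E (P, e P)) \<and>
        (\<forall>P\<in>E. \<forall>Q\<in>E. P \<noteq> Q \<longrightarrow> e P \<noteq> e Q)) \<and>
     (\<forall>f\<in>S. \<forall>Q. mono_divides Q (snd f) \<longrightarrow> (\<exists>g\<in>S. snd g = Q \<and> shorter g f))"

definition arrow_ends :: "(monomial \<times> monomial) set \<Rightarrow> monomial set" where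
  "arrow_ends S = snd ` S"

definition box :: "nat \<Rightarrow> nat \<Rightarrow> monomial set" where
  "box M N = {(x, y). x < M \<and> y < N}"

definition dual_staircase :: "nat \<Rightarrow> nat \<Rightarrow> monomial set \<Rightarrow> monomial set" where
  "dual_staircase M N E = {(x, y). (x, y) \<in> box M N \<and> (M - 1 - x, N - 1 - y) \<notin> E}"

text \<open>
  A sequence \<open>(p\<^sub>1, \<dots>, p\<^sub>n)\<close> is a function on \<open>nat\<close> of which only the values on \<open>{1..n}\<close> matter.
  If it is non-increasing with \<open>p\<^sub>1 \<le> r + 1 - n\<close> and \<open>n \<le> r + 1\<close>, then none of the
  subtractions below truncates.
\<close>

definition staircase_of :: "nat \<Rightarrow> nat \<Rightarrow> (nat \<Rightarrow> nat) \<Rightarrow> monomial set" where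
  "staircase_of r n p =
     {P. total_degree P < r} \<union>
     ({P. total_degree P = r} - (\<lambda>i. (n - i + p i, r + i - n - p i)) ` {1..n})"


text \<open>The vector space \<open>k[x, y]\<close>: a polynomial is its finitely supported coefficient function.\<close>

type_synonym 'k kxy = "monomial \<Rightarrow>\<^sub>0 'k"

definition kxy_scale :: "'k::field \<Rightarrow> 'k kxy \<Rightarrow> 'k kxy" where
  "kxy_scale c f = Poly_Mapping.map ((*) c) f"

lemma lookup_kxy_scale: "Poly_Mapping.lookup (kxy_scale c f) P = c * Poly_Mapping.lookup f P"
  by (simp add: kxy_scale_def Poly_Mapping.map.rep_eq when_def)

interpretation kxy: vector_space "kxy_scale :: 'k::field \<Rightarrow> 'k kxy \<Rightarrow> 'k kxy"
  by unfold_locales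
     (auto intro!: poly_mapping_eqI simp: lookup_kxy_scale lookup_add algebra_simps)

definition homogeneous :: "nat \<Rightarrow> 'k::field kxy set" where
  "homogeneous r = {f. \<forall>P\<in>Poly_Mapping.keys f. total_degree P = r}"

definition grassmannian :: "nat \<Rightarrow> nat \<Rightarrow> 'k::field kxy set set" where
  "grassmannian n r = {W. kxy.subspace W \<and> W \<subseteq> homogeneous r \<and> kxy.dim W = n}"

text \<open>
  The \<open>s\<close>-th smallest monomial of degree \<open>r\<close>, counting from \<open>s = 0\<close>, is \<open>x\<^bsup>r-s\<^esup> y\<^sup>s\<close>; the flag is
  meant for \<open>j \<le> r + 1\<close>.
\<close>

definition flag :: "nat \<Rightarrow> nat \<Rightarrow> 'k::field kxy set" where
  "flag r j = kxy.span ((\<lambda>s. Poly_Mapping.single (r - s, s) 1) ` {..<j})"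

definition schubert_cell :: "nat \<Rightarrow> nat \<Rightarrow> (nat \<Rightarrow> nat) \<Rightarrow> 'k::field kxy set set" where
  "schubert_cell r n p =
     {W \<in> grassmannian n r.
        \<forall>i\<le>n. \<forall>j\<le>r + 1.
          (0 < i \<longrightarrow> r + 1 - n + i - p i \<le> j) \<and>
          (i < n \<longrightarrow> j < r + 1 - n + (i + 1) - p (i + 1)) \<longrightarrow>
          kxy.dim (W \<inter> flag r j) = i}"


text \<open>
  The Zariski topology of the Grassmannian, through the Pluecker embedding. The coordinates are
  indexed by the \<open>n\<close>-element subsets \<open>I\<close> of \<open>{0..r}\<close>: the coordinate at \<open>I\<close> of the span of the
  basis \<open>B\<close> is the maximal minor of the coefficient matrix of \<open>B\<close> in the columns \<open>I\<close>.
\<close>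

definition ordered_basis :: "'k::field kxy list \<Rightarrow> 'k kxy set \<Rightarrow> bool" where
  "ordered_basis B W \<longleftrightarrow>
     distinct B \<and> kxy.independent (set B) \<and> kxy.span (set B) = W"

definition pluecker_index :: "nat \<Rightarrow> nat \<Rightarrow> nat set set" where
  "pluecker_index n r = {I. I \<subseteq> {0..r} \<and> card I = n}"

definition pluecker :: "nat \<Rightarrow> nat \<Rightarrow> 'k::field kxy list \<Rightarrow> nat set \<Rightarrow> 'k" where
  "pluecker n r B I =
     Determinant.det (Matrix.mat n n
       (\<lambda>(a, b). let s = sorted_list_of_set I ! b in Poly_Mapping.lookup (B ! a) (r - s, s)))"

text \<open>
  Multivariate polynomials with variables indexed by \<open>'i\<close>: a finitely supported coefficient
  function on monomials, which are finitely supported exponent functions.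
\<close>

type_synonym ('i, 'k) mpol = "('i \<Rightarrow>\<^sub>0 nat) \<Rightarrow>\<^sub>0 'k"

definition mpol_eval :: "('i \<Rightarrow> 'k::field) \<Rightarrow> ('i, 'k) mpol \<Rightarrow> 'k" where
  "mpol_eval v F = (\<Sum>m\<in>Poly_Mapping.keys F. Poly_Mapping.lookup F m * (\<Prod>i\<in>Poly_Mapping.keys m. v i ^ Poly_Mapping.lookup m i))"

definition mpol_homogeneous :: "'i set \<Rightarrow> nat \<Rightarrow> ('i, 'k::field) mpol \<Rightarrow> bool" where
  "mpol_homogeneous X d F \<longleftrightarrow>
     (\<forall>m\<in>Poly_Mapping.keys F. Poly_Mapping.keys m \<subseteq> X \<and> (\<Sum>i\<in>Poly_Mapping.keys m. Poly_Mapping.lookup m i) = d)"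

text \<open>
  Another basis of \<open>W\<close> multiplies all the Pluecker coordinates by the same nonzero scalar, so for
  homogeneous \<open>F\<close> the condition below does not depend on \<open>B\<close>.
\<close>

definition nonvanishing_locus :: "nat \<Rightarrow> nat \<Rightarrow> (nat set, 'k::field) mpol \<Rightarrow> 'k kxy set set" where
  "nonvanishing_locus n r F =
     {W \<in> grassmannian n r. \<exists>B. ordered_basis B W \<and> mpol_eval (pluecker n r B) F \<noteq> 0}"

definition zariski_grassmannian :: "nat \<Rightarrow> nat \<Rightarrow> 'k::field kxy set topology" where
  "zariski_grassmannian n r =
     topology_generated_by
       {nonvanishing_locus n r F | F d. mpol_homogeneous (pluecker_index n r) d F}"

end

theory Submission
  imports Defs
begin

text \<open>
  A sequence \<open>p\<close> is encoded by the increasing sequence \<open>s\<^sub>i = r + i - n - p\<^sub>i\<close>, and \<open>q\<close> by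
  \<open>t\<^sub>i = r + i - n - q\<^sub>i\<close> (\<open>jump\<close>). The condition \<open>q\<^sub>i \<ge> p\<^sub>i\<close> for all \<open>i\<close> says
  \<open>t\<^sub>i \<le> s\<^sub>i\<close> for all \<open>i\<close>, that is, some bijection from the set \<open>T\<close> of the \<open>t\<^sub>i\<close> to the set \<open>S\<close> of the
  \<open>s\<^sub>i\<close> never decreases (\<open>shiftable_strict_mono_images\<close>). Every condition of the theorem is
  compared with this one.

  \<^emph>\<open>Arrows.\<close> Arrows keep the degree and move towards higher powers of \<open>y\<close>. The two staircases
  agree except in degree \<open>r\<close>, their top degree, where they consist of the complements of \<open>S\<close> and of \<open>T\<close>.
  A system of arrows between them is therefore the same as a nondecreasing bijection from the
  complement of \<open>S\<close> to that of \<open>T\<close> (\<open>arrow_system_iff_shiftable\<close>). Such bijections are governed by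
  counting the elements below each threshold, so complements, and likewise reflections, reverse
  the order (\<open>shiftable_complement\<close>, \<open>shiftable_reflect\<close>). The dual staircases differ only in
  degree \<open>M + N - 2 - r\<close>, where they consist of the reflections of the removed monomials that
  lie in the box, and the removed monomials outside the box are common to \<open>p\<close> and \<open>q\<close>.

  \<^emph>\<open>Schubert cells.\<close> The elements of \<open>S\<close> are the pivots of every \<open>W\<close> in the cell of \<open>p\<close>. If the
  closure of this cell meets the cell of \<open>q\<close>, then some \<open>V\<close> in the cell of \<open>p\<close> has a nonzero
  Pluecker coordinate at \<open>T\<close>, which means that \<open>V\<close> injects into the coordinates in \<open>T\<close>
  (\<open>pluecker_eq_0_iff\<close>). The vectors of \<open>V\<close> with highest coordinate at most \<open>s\<^sub>i\<close> form a space of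
  dimension \<open>i\<close>, so \<open>T\<close> has at least \<open>i\<close> elements up to \<open>s\<^sub>i\<close>, and \<open>t\<^sub>i \<le> s\<^sub>i\<close>.
  Conversely, if \<open>t\<^sub>i \<le> s\<^sub>i\<close> for all \<open>i\<close>, then the spaces spanned by
  \<open>(1 - x) m(t\<^sub>i) + x m(s\<^sub>i)\<close>, where \<open>m(u)\<close> is the monomial of degree \<open>r\<close> with exponent \<open>u\<close> of \<open>y\<close>,
  lie in the cell of \<open>p\<close> for \<open>x \<noteq> 0\<close> and in the cell of \<open>q\<close> for \<open>x = 0\<close>. A form in the Pluecker
  coordinates that is nonzero at \<open>x = 0\<close> is nonzero for all but finitely many \<open>x\<close>, and the field is
  infinite, so the space at \<open>x = 0\<close> lies in the closure (\<open>open_contains_almost_all_of_family\<close>).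
\<close>

section \<open>Nondecreasing bijections between sets of integers\<close>

text \<open>
  For sets of equal finite size this is the order that compares the elements rank by rank.
  It is phrased through a bijection because the ends of a system of arrows are given by one.
\<close>

definition shiftable :: "nat set \<Rightarrow> nat set \<Rightarrow> bool" where
  "shiftable U V \<longleftrightarrow> (\<exists>h. bij_betw h U V \<and> (\<forall>u\<in>U. u \<le> h u))"

lemma shiftable_imp_counts:
  assumes "finite U" and "shiftable U V"
  shows "card U = card V" and "card {v\<in>V. v < c} \<le> card {u\<in>U. u < c}"
proof -
  obtain h where h: "bij_betw h U V" and le: "\<forall>u\<in>U. u \<le> h u"
    using assms(2) by (auto simp: shiftable_def)
  show "card U = card V" using h by (rule bij_betw_same_card)
  have "{v\<in>V. v < c} \<subseteq> h ` {u\<in>U. u < c}"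
  proof
    fix v assume v: "v \<in> {v\<in>V. v < c}"
    then obtain u where "u \<in> U" "v = h u" using h by (auto simp: bij_betw_def)
    then show "v \<in> h ` {u\<in>U. u < c}" using v le by (auto intro: le_less_trans)
  qed
  then show "card {v\<in>V. v < c} \<le> card {u\<in>U. u < c}"
    using assms(1) by (intro surj_card_le) auto
qed

text \<open>
  Match the largest elements and recurse. Counting below \<open>Max V + 1\<close> shows \<open>Max U \<le> Max V\<close>,
  and removing the two maxima keeps the counts comparable.
\<close>

lemma counts_imp_shiftable:
  assumes "finite U" "finite V" "card U = card V"
    and "\<And>c. card {v\<in>V. v < c} \<le> card {u\<in>U. u < c}"
  shows "shiftable U V"
  using assms
proof (induction "card U" arbitrary: U V)
  case 0
  then show ?case by (auto simp: shiftable_def bij_betw_def)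
next
  case (Suc m)
  note fin = Suc.prems(1,2) and counts = Suc.prems(4)
  have ne: "U \<noteq> {}" "V \<noteq> {}" using Suc.hyps(2) Suc.prems(3) by auto
  define a b where "a = Max U" and "b = Max V"
  have a: "a \<in> U" "\<And>u. u \<in> U \<Longrightarrow> u \<le> a" using fin ne by (auto simp: a_def)
  have b: "b \<in> V" "\<And>v. v \<in> V \<Longrightarrow> v \<le> b" using fin ne by (auto simp: b_def)
  have "{v\<in>V. v < Suc b} = V" using b by (auto simp: less_Suc_eq_le)
  then have "card U \<le> card {u\<in>U. u < Suc b}" using counts[of "Suc b"] Suc.prems(3) by simp
  then have "{u\<in>U. u < Suc b} = U" using fin by (intro card_seteq) auto
  then have "a \<in> {u\<in>U. u < Suc b}" using a(1) by simp
  then have ab: "a \<le> b" by simp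
  have "shiftable (U - {a}) (V - {b})"
  proof (rule Suc.hyps(1))
    show "m = card (U - {a})" "card (U - {a}) = card (V - {b})"
      using Suc.hyps(2) Suc.prems(3) a b by auto
    fix c
    show "card {v\<in>V - {b}. v < c} \<le> card {u\<in>U - {a}. u < c}"
    proof (cases "a < c")
      case True
      then have "{u\<in>U - {a}. u < c} = U - {a}" using a by (auto intro: le_less_trans)
      moreover have "card {v\<in>V - {b}. v < c} \<le> card (V - {b})"
        using fin by (intro card_mono) auto
      ultimately show ?thesis using Suc.prems(3) a b by simp
    next
      case False
      then have "{v\<in>V - {b}. v < c} = {v\<in>V. v < c}" "{u\<in>U - {a}. u < c} = {u\<in>U. u < c}"
        using ab by auto
      then show ?thesis using counts by simp
    qed
  qed (use fin in auto)
  then obtain h where h: "bij_betw h (U - {a}) (V - {b})" "\<forall>u\<in>U - {a}. u \<le> h u"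
    by (auto simp: shiftable_def)
  have "bij_betw (h(a := b)) (insert a (U - {a})) (insert b (V - {b}))"
  proof -
    have "bij_betw (h(a := b)) (U - {a}) (V - {b})"
      using h(1) by (subst bij_betw_cong[of _ _ h]) auto
    then show ?thesis by (subst notIn_Un_bij_betw3[of a _ "h(a := b)", simplified, symmetric]) auto
  qed
  then have "bij_betw (h(a := b)) U V" using a b by (simp add: insert_absorb)
  moreover have "\<forall>u\<in>U. u \<le> (h(a := b)) u" using h(2) ab by auto
  ultimately show ?case by (auto simp: shiftable_def)
qed

lemma shiftable_iff_counts:
  assumes "finite U" "finite V"
  shows "shiftable U V \<longleftrightarrow> card U = card V \<and> (\<forall>c. card {v\<in>V. v < c} \<le> card {u\<in>U. u < c})"
  using shiftable_imp_counts[OF assms(1)] counts_imp_shiftable[OF assms] by blast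

text \<open>
  Counts below a threshold in a set and in its complement add up to a constant, so passing to
  complements reverses the order. This turns a condition on the removed monomials into a condition
  on the monomials that remain in the staircase.
\<close>

lemma shiftable_complement:
  assumes X: "finite X" and "U \<subseteq> X" "V \<subseteq> X"
  shows "shiftable (X - U) (X - V) \<longleftrightarrow> shiftable V U"
proof -
  have fin: "finite U" "finite V" using assms finite_subset by auto
  have count: "card {x\<in>X - Y. x < c} = card {x\<in>X. x < c} - card {x\<in>Y. x < c}
      \<and> card {x\<in>Y. x < c} \<le> card {x\<in>X. x < c}" if "Y \<subseteq> X" for Y c
  proof -
    have eq: "{x\<in>X - Y. x < c} = {x\<in>X. x < c} - {x\<in>Y. x < c}" by auto
    have sub: "{x\<in>Y. x < c} \<subseteq> {x\<in>X. x < c}" using that by auto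
    have f: "finite {x\<in>Y. x < c}" "finite {x\<in>X. x < c}" by auto
    show ?thesis unfolding eq using card_Diff_subset[OF f(1) sub] card_mono[OF f(2) sub] by blast
  qed
  have tot: "card (X - Y) = card X - card Y \<and> card Y \<le> card X" if "Y \<subseteq> X" for Y
    using card_Diff_subset[OF finite_subset[OF that X] that] card_mono[OF X that] by blast
  have "card (X - U) = card (X - V) \<longleftrightarrow> card V = card U"
    using tot[OF assms(2)] tot[OF assms(3)] by linarith
  moreover have "card {x\<in>X - V. x < c} \<le> card {x\<in>X - U. x < c}
      \<longleftrightarrow> card {x\<in>U. x < c} \<le> card {x\<in>V. x < c}" for c
    using count[OF assms(2), of c] count[OF assms(3), of c] by linarith
  ultimately show ?thesis
    unfolding shiftable_iff_counts[OF fin(2,1)]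
      shiftable_iff_counts[OF finite_Diff[OF X] finite_Diff[OF X]] by blast
qed

lemma shiftable_reflect_imp:
  assumes "U \<subseteq> {..<N}" "V \<subseteq> {..<N}" "shiftable U V"
  shows "shiftable ((\<lambda>s. N - 1 - s) ` V) ((\<lambda>s. N - 1 - s) ` U)"
proof -
  let ?\<rho> = "\<lambda>s. N - 1 - s"
  obtain h where h: "bij_betw h U V" and le: "\<forall>u\<in>U. u \<le> h u"
    using assms(3) by (auto simp: shiftable_def)
  let ?g = "?\<rho> \<circ> inv_into U h \<circ> ?\<rho>"
  have inv: "?\<rho> (?\<rho> s) = s" if "s < N" for s using that by auto
  have inj: "inj_on ?\<rho> {..<N}" by (auto simp: inj_on_def)
  have onto_V: "bij_betw ?\<rho> (?\<rho> ` V) V"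
  proof -
    have "?\<rho> ` ?\<rho> ` V = (\<lambda>s. s) ` V"
      unfolding image_image using assms(2) inv by (intro image_cong) auto
    moreover have "inj_on ?\<rho> (?\<rho> ` V)"
      using assms(2) inv by (auto simp: inj_on_def subset_iff)
    ultimately show ?thesis by (simp add: bij_betw_def)
  qed
  have from_V: "bij_betw (inv_into U h) V U" using h by (rule bij_betw_inv_into)
  have onto_U: "bij_betw ?\<rho> U (?\<rho> ` U)"
    using inj assms(1) by (auto simp: bij_betw_def intro: inj_on_subset)
  have "bij_betw ?g (?\<rho> ` V) (?\<rho> ` U)"
    by (simp only: comp_assoc) (rule bij_betw_trans[OF bij_betw_trans[OF onto_V from_V] onto_U, unfolded comp_assoc])
  moreover have "w \<le> ?g w" if "w \<in> ?\<rho> ` V" for w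
  proof -
    from that obtain v where v: "v \<in> V" "w = ?\<rho> v" by (rule imageE)
    then obtain u where u: "u \<in> U" "v = h u" using h by (auto simp: bij_betw_def)
    have "?\<rho> w = v" using v assms(2) by auto
    then have "?g w = ?\<rho> u" using u h by (simp add: bij_betw_def)
    then show ?thesis using u v le by (auto intro: diff_le_mono2)
  qed
  ultimately show ?thesis by (auto simp: shiftable_def)
qed

text \<open>
  Duality of staircases acts on exponents by a reflection, which reverses the order as well.
\<close>

lemma shiftable_reflect:
  assumes "U \<subseteq> {..<N}" "V \<subseteq> {..<N}"
  shows "shiftable ((\<lambda>s. N - 1 - s) ` V) ((\<lambda>s. N - 1 - s) ` U) \<longleftrightarrow> shiftable U V"
proof
  assume *: "shiftable ((\<lambda>s. N - 1 - s) ` V) ((\<lambda>s. N - 1 - s) ` U)"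
  have invol: "(\<lambda>s. N - 1 - s) ` (\<lambda>s. N - 1 - s) ` Y = Y" if "Y \<subseteq> {..<N}" for Y
  proof -
    have "(\<lambda>s. N - 1 - (N - 1 - s)) ` Y = (\<lambda>s. s) ` Y" using that by (intro image_cong) auto
    then show ?thesis by (simp add: image_image)
  qed
  have below: "(\<lambda>s. N - 1 - s) ` Y \<subseteq> {..<N}" if "Y \<subseteq> {..<N}" for Y
  proof
    fix x assume "x \<in> (\<lambda>s. N - 1 - s) ` Y"
    then obtain s where "s \<in> Y" "x = N - 1 - s" by (rule imageE)
    then show "x \<in> {..<N}" using that by auto
  qed
  show "shiftable U V"
    using shiftable_reflect_imp[OF below[OF assms(2)] below[OF assms(1)] *]
    unfolding invol[OF assms(1)] invol[OF assms(2)] .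
qed (rule shiftable_reflect_imp[OF assms])

text \<open>
  If the \<open>i\<close>-th term exceeded \<open>c\<close>, then only the first \<open>i - 1\<close> terms could be at most \<open>c\<close>.
\<close>

lemma strict_mono_on_le_of_count:
  fixes t :: "nat \<Rightarrow> nat"
  assumes t: "strict_mono_on {1..n} t" and i: "i \<in> {1..n}"
    and "i \<le> card {u\<in>t ` {1..n}. u < Suc c}"
  shows "t i \<le> c"
proof (rule ccontr)
  assume "\<not> t i \<le> c"
  have "{u\<in>t ` {1..n}. u < Suc c} \<subseteq> t ` {1..<i}"
  proof
    fix u assume "u \<in> {u\<in>t ` {1..n}. u < Suc c}"
    then obtain k where k: "k \<in> {1..n}" "u = t k" "t k \<le> c" by auto
    have "k < i"
      using strict_mono_on_leD[OF t i k(1)] k(3) \<open>\<not> t i \<le> c\<close> by linarith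
    then show "u \<in> t ` {1..<i}" using k by auto
  qed
  then have "card {u\<in>t ` {1..n}. u < Suc c} \<le> card {1..<i}"
    by (rule surj_card_le[rotated]) simp
  moreover have "card {1..<i} < i" using i by simp
  ultimately show False using assms(3) by linarith
qed

lemma shiftable_strict_mono_images:
  fixes s t :: "nat \<Rightarrow> nat"
  assumes s: "strict_mono_on {1..n} s" and t: "strict_mono_on {1..n} t"
  shows "shiftable (t ` {1..n}) (s ` {1..n}) \<longleftrightarrow> (\<forall>i\<in>{1..n}. t i \<le> s i)"
proof -
  have inj: "inj_on t {1..n}" "inj_on s {1..n}"
    using s t by (auto intro: strict_mono_on_imp_inj_on)
  have "shiftable (t ` {1..n}) (s ` {1..n})" if le: "\<forall>i\<in>{1..n}. t i \<le> s i"
  proof -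
    have "bij_betw (s \<circ> inv_into {1..n} t) (t ` {1..n}) (s ` {1..n})"
      using inj by (intro bij_betw_trans[OF bij_betw_inv_into]) (auto simp: bij_betw_def)
    then show ?thesis
      using inj le unfolding shiftable_def by (intro exI conjI) auto
  qed
  moreover have "t i \<le> s i" if *: "shiftable (t ` {1..n}) (s ` {1..n})" and i: "i \<in> {1..n}" for i
  proof -
    have "s ` {1..i} \<subseteq> {v\<in>s ` {1..n}. v < Suc (s i)}"
    proof
      fix v assume "v \<in> s ` {1..i}"
      then obtain k where k: "k \<in> {1..i}" "v = s k" by blast
      then have "k \<in> {1..n}" "s k \<le> s i" using i strict_mono_on_leD[OF s, of k i] by auto
      then show "v \<in> {v\<in>s ` {1..n}. v < Suc (s i)}" using k by (auto simp: less_Suc_eq_le)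
    qed
    then have "card (s ` {1..i}) \<le> card {v\<in>s ` {1..n}. v < Suc (s i)}"
      by (intro card_mono) auto
    moreover have "card (s ` {1..i}) = i"
    proof -
      have "inj_on s {1..i}" using inj(2) by (rule inj_on_subset) (use i in auto)
      then show ?thesis by (simp add: card_image)
    qed
    ultimately have "i \<le> card {v\<in>t ` {1..n}. v < Suc (s i)}"
      using shiftable_imp_counts(2)[OF _ *, of "Suc (s i)"] by simp
    then show "t i \<le> s i" by (rule strict_mono_on_le_of_count[OF t i])
  qed
  ultimately show ?thesis by blast
qed

section \<open>Systems of arrows between staircases that differ in one degree\<close>

definition degree_slice :: "monomial set \<Rightarrow> nat \<Rightarrow> nat set" where
  "degree_slice E d = {y. y \<le> d \<and> (d - y, y) \<in> E}"

lemma degree_slice_bij: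
  "bij_betw (\<lambda>y. (d - y, y)) (degree_slice E d) {P\<in>E. total_degree P = d}"
  by (rule bij_betw_byWitness[where f' = snd]) (auto simp: degree_slice_def total_degree_def)

lemma staircase_downward:
  assumes "staircase E" and "Q \<in> E" and "mono_divides P Q"
  shows "P \<in> E"
  using assms unfolding staircase_def mono_divides_def by blast

lemma vec_multiple_iff:
  "vec_multiple (P, Q) l \<longleftrightarrow> l = int (snd P) - int (snd Q) \<and> total_degree P = total_degree Q"
  by (auto simp: vec_multiple_def total_degree_def)

lemma arrow_on_iff:
  "arrow_on E (P, Q) \<longleftrightarrow> P \<in> E \<and> total_degree P = total_degree Q \<and> snd P \<le> snd Q"
  by (auto simp: arrow_on_def vec_multiple_iff)

lemma mono_divides_degree:
  assumes "mono_divides P Q" and "P \<noteq> Q"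
  shows "total_degree P < total_degree Q"
proof -
  obtain R where R: "Q = P + R" using assms(1) by (auto simp: mono_divides_def)
  then have "total_degree Q = total_degree P + total_degree R" by (simp add: total_degree_def)
  moreover have "total_degree R \<noteq> 0"
    using R assms(2) by (cases P; cases R) (auto simp: total_degree_def)
  ultimately show ?thesis by simp
qed

text \<open>
  An arrow keeps the degree and does not decrease the exponent of \<open>y\<close>, so a system of arrows
  restricts to a shift in every degree.
\<close>

lemma arrow_system_imp_shiftable:
  assumes S: "arrow_system A S" and ends: "arrow_ends S = B"
  shows "shiftable (degree_slice A d) (degree_slice B d)"
proof -
  obtain e where Se: "S = (\<lambda>P. (P, e P)) ` A" and arr: "\<And>P. P \<in> A \<Longrightarrow> arrow_on A (P, e P)"
    and inj: "inj_on e A"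
    using S unfolding arrow_system_def inj_on_def by blast
  have B: "B = e ` A" using ends by (auto simp: arrow_ends_def Se image_image)
  have deg: "total_degree (e P) = total_degree P" and le: "snd P \<le> snd (e P)" if "P \<in> A" for P
    using arr[OF that] by (auto simp: arrow_on_iff)
  have e: "bij_betw e {P\<in>A. total_degree P = d} {P\<in>B. total_degree P = d}"
  proof (rule bij_betw_imageI)
    show "inj_on e {P\<in>A. total_degree P = d}" using inj by (rule inj_on_subset) auto
    show "e ` {P\<in>A. total_degree P = d} = {P\<in>B. total_degree P = d}" using deg by (auto simp: B)
  qed
  have snd: "bij_betw snd {P\<in>B. total_degree P = d} (degree_slice B d)"
    by (rule bij_betw_byWitness[where f' = "\<lambda>y. (d - y, y)"])
       (auto simp: degree_slice_def total_degree_def)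
  have "bij_betw (snd \<circ> (e \<circ> (\<lambda>y. (d - y, y)))) (degree_slice A d) (degree_slice B d)"
    by (rule bij_betw_trans[OF bij_betw_trans[OF degree_slice_bij e] snd])
  moreover have "y \<le> (snd \<circ> (e \<circ> (\<lambda>y. (d - y, y)))) y" if "y \<in> degree_slice A d" for y
    using that le[of "(d - y, y)"] by (simp add: degree_slice_def)
  ultimately show ?thesis unfolding shiftable_def by blast
qed

text \<open>
  Use the shift in the top degree \<open>d\<close> and zero arrows elsewhere. The divisor condition is then
  automatic: a proper divisor of an end has degree below \<open>d\<close>, hence is the end of its own zero arrow,
  which is shorter than every other arrow.
\<close>

lemma shiftable_imp_arrow_system:
  assumes A: "staircase A" and B: "staircase B"
    and agree: "\<And>P. total_degree P \<noteq> d \<Longrightarrow> P \<in> A \<longleftrightarrow> P \<in> B"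
    and top: "\<And>P. P \<in> B \<Longrightarrow> total_degree P \<le> d"
    and shift: "shiftable (degree_slice A d) (degree_slice B d)"
  shows "\<exists>S. arrow_system A S \<and> arrow_ends S = B"
proof -
  obtain h where h: "bij_betw h (degree_slice A d) (degree_slice B d)"
    and le: "\<And>y. y \<in> degree_slice A d \<Longrightarrow> y \<le> h y"
    using shift by (auto simp: shiftable_def)
  define e where "e P = (if total_degree P = d then (d - h (snd P), h (snd P)) else P)" for P
  define S where "S = (\<lambda>P. (P, e P)) ` A"
  have slice: "snd P \<in> degree_slice A d" if "P \<in> A" "total_degree P = d" for P
    using that by (cases P) (auto simp: degree_slice_def total_degree_def)
  have hB: "h (snd P) \<in> degree_slice B d" if "P \<in> A" "total_degree P = d" for P
    using slice[OF that] h by (auto simp: bij_betw_def)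
  have hd: "h (snd P) \<le> d" if "P \<in> A" "total_degree P = d" for P
    using hB[OF that] by (auto simp: degree_slice_def)
  have deg: "total_degree (e P) = total_degree P" if "P \<in> A" for P
    using hd[OF that] by (auto simp: e_def total_degree_def)
  have up: "snd P \<le> snd (e P)" if "P \<in> A" for P
    using le slice that by (auto simp: e_def)
  have inj: "P = Q" if "P \<in> A" "Q \<in> A" "e P = e Q" for P Q
  proof (cases "total_degree P = d")
    case True
    then have Qd: "total_degree Q = d" using deg[OF that(1)] deg[OF that(2)] that(3) by simp
    then have "h (snd P) = h (snd Q)" using that(3) True by (simp add: e_def)
    then have "snd P = snd Q"
      using h slice[OF that(1) True] slice[OF that(2) Qd] by (auto simp: bij_betw_def inj_on_def)
    then show ?thesis using True Qd by (cases P; cases Q) (auto simp: total_degree_def)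
  next
    case False
    then have "total_degree Q \<noteq> d" using deg[OF that(1)] deg[OF that(2)] that(3) by simp
    then show ?thesis using that False by (simp add: e_def)
  qed
  have image: "e ` A = B"
  proof
    show "e ` A \<subseteq> B"
    proof (rule image_subsetI)
      fix P assume P: "P \<in> A"
      show "e P \<in> B"
      proof (cases "total_degree P = d")
        case True
        then show ?thesis using hB[OF P True] by (simp add: e_def degree_slice_def)
      next
        case False
        then show ?thesis using agree[OF False] P by (simp add: e_def)
      qed
    qed
    show "B \<subseteq> e ` A"
    proof
      fix P assume P: "P \<in> B"
      show "P \<in> e ` A"
      proof (cases "total_degree P = d")
        case True
        then have "snd P \<in> degree_slice B d"
          using P by (cases P) (auto simp: degree_slice_def total_degree_def)
        then obtain y where y: "y \<in> degree_slice A d" "h y = snd P"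
          using h by (metis bij_betw_imp_surj_on imageE)
        then have "(d - y, y) \<in> A" "total_degree (d - y, y) = d"
          by (auto simp: degree_slice_def total_degree_def)
        moreover have "e (d - y, y) = P"
          using calculation(2) True y(2) by (cases P) (auto simp: e_def total_degree_def)
        ultimately show ?thesis by (metis imageI)
      next
        case False
        then have "P \<in> A" "e P = P" using P agree[OF False] by (simp_all add: e_def)
        then show ?thesis by (metis imageI)
      qed
    qed
  qed
  have system: "\<exists>g\<in>S. snd g = Q \<and> shorter g f" if f: "f \<in> S" and Q: "mono_divides Q (snd f)" for f Q
  proof -
    obtain P where P: "P \<in> A" "f = (P, e P)" using f by (auto simp: S_def)
    show ?thesis
    proof (cases "Q = e P")
      case True
      have "shorter f f" using P deg[OF P(1)] by (simp add: shorter_def vec_multiple_iff)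
      then show ?thesis using True P f by (intro bexI[of _ f]) simp_all
    next
      case False
      have eP: "snd f = e P" "e P \<in> B" using P imageI[OF P(1), of e] by (simp_all add: image)
      then have "Q \<in> B" using staircase_downward[OF B _ Q] by simp
      moreover have "total_degree Q < d"
        using mono_divides_degree[OF Q] False eP top[OF eP(2)] by simp
      ultimately have "Q \<in> A" "e Q = Q" using agree[of Q] by (simp_all add: e_def)
      then have "(Q, Q) \<in> S" unfolding S_def by (metis imageI)
      moreover have "shorter (Q, Q) f"
        using P deg[OF P(1)] by (simp add: shorter_def vec_multiple_iff)
      ultimately show ?thesis by (intro bexI[of _ "(Q, Q)"]) simp_all
    qed
  qed
  have "arrow_system A S"
    unfolding arrow_system_def
  proof (intro conjI exI[of _ e])
    show "\<forall>P\<in>A. arrow_on A (P, e P)" using deg up by (simp add: arrow_on_iff)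
    show "\<forall>P\<in>A. \<forall>Q\<in>A. P \<noteq> Q \<longrightarrow> e P \<noteq> e Q" using inj by blast
    show "\<forall>f\<in>S. \<forall>Q. mono_divides Q (snd f) \<longrightarrow> (\<exists>g\<in>S. snd g = Q \<and> shorter g f)"
      using system by blast
  qed (fact A, fact S_def)
  moreover have "arrow_ends S = B" using image by (simp add: arrow_ends_def S_def image_image)
  ultimately show ?thesis by blast
qed

lemma arrow_system_iff_shiftable:
  assumes "staircase A" and "staircase B"
    and "\<And>P. total_degree P \<noteq> d \<Longrightarrow> P \<in> A \<longleftrightarrow> P \<in> B"
    and "\<And>P. P \<in> B \<Longrightarrow> total_degree P \<le> d"
  shows "(\<exists>S. arrow_system A S \<and> arrow_ends S = B)
    \<longleftrightarrow> shiftable (degree_slice A d) (degree_slice B d)"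
proof
  assume "\<exists>S. arrow_system A S \<and> arrow_ends S = B"
  then obtain S where "arrow_system A S" "arrow_ends S = B" by (elim exE conjE)
  then show "shiftable (degree_slice A d) (degree_slice B d)" by (rule arrow_system_imp_shiftable)
next
  assume shift: "shiftable (degree_slice A d) (degree_slice B d)"
  have agree: "total_degree P \<noteq> d \<Longrightarrow> P \<in> A \<longleftrightarrow> P \<in> B" for P by (rule assms(3))
  have top: "P \<in> B \<Longrightarrow> total_degree P \<le> d" for P by (rule assms(4))
  show "\<exists>S. arrow_system A S \<and> arrow_ends S = B"
    by (rule shiftable_imp_arrow_system[OF assms(1,2) _ _ shift]) (erule agree, erule top)
qed

section \<open>The staircase of a sequence and its dual\<close>

text \<open>
  This number is the exponent of \<open>y\<close> of the \<open>i\<close>-th monomial removed in \<open>staircase_of\<close>, and it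
  is also the index at which the dimension of \<open>W \<inter> V\<^sub>j\<close> passes from \<open>i - 1\<close> to \<open>i\<close> when
  \<open>j\<close> passes from it to its successor, for \<open>W\<close> in the Schubert cell. The whole theorem is a
  comparison of two such increasing sequences.
\<close>

definition jump :: "nat \<Rightarrow> nat \<Rightarrow> (nat \<Rightarrow> nat) \<Rightarrow> nat \<Rightarrow> nat" where
  "jump r n p i = r + i - n - p i"

locale admissible_sequence =
  fixes r n :: nat and p :: "nat \<Rightarrow> nat"
  assumes n_pos: "1 \<le> n" and n_le: "n \<le> r + 1"
    and antimono: "antimono_on {1..n} p" and first_le: "p 1 \<le> r + 1 - n"
begin

lemma entry_le: "i \<in> {1..n} \<Longrightarrow> p i + n \<le> r + 1"
proof -
  assume i: "i \<in> {1..n}"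
  then have "p i \<le> p 1" using monotone_onD[OF antimono, of 1 i] n_pos by simp
  then show ?thesis using first_le n_le by linarith
qed

lemma jump_add: "i \<in> {1..n} \<Longrightarrow> jump r n p i + p i + n = r + i"
  using entry_le[of i] by (auto simp: jump_def)

lemma jump_le: "i \<in> {1..n} \<Longrightarrow> jump r n p i \<le> r"
  using jump_add[of i] by auto

lemma jump_strict_mono: "strict_mono_on {1..n} (jump r n p)"
proof (rule strict_mono_onI)
  fix i k assume *: "i \<in> {1..n}" "k \<in> {1..n}" "i < k"
  then have "p k \<le> p i" using monotone_onD[OF antimono *(1,2)] by simp
  then show "jump r n p i < jump r n p k" using jump_add[OF *(1)] jump_add[OF *(2)] *(3) by linarith
qed

lemma jump_inj: "inj_on (jump r n p) {1..n}"
  using jump_strict_mono by (rule strict_mono_on_imp_inj_on)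

lemma jumps_subset: "jump r n p ` {1..n} \<subseteq> {..r}"
  using jump_le by auto

lemma staircase_of_alt:
  "staircase_of r n p = {P. total_degree P \<le> r \<and>
     (total_degree P = r \<longrightarrow> snd P \<notin> jump r n p ` {1..n})}"
proof -
  have removed: "(n - i + p i, r + i - n - p i) = (r - jump r n p i, jump r n p i)" if "i \<in> {1..n}" for i
    using jump_add[OF that] that by (auto simp: jump_def)
  have "(\<lambda>i. (n - i + p i, r + i - n - p i)) ` {1..n} = (\<lambda>i. (r - jump r n p i, jump r n p i)) ` {1..n}"
    using removed by (intro image_cong) auto
  moreover have "P \<in> (\<lambda>i. (r - jump r n p i, jump r n p i)) ` {1..n} \<longleftrightarrow> snd P \<in> jump r n p ` {1..n}"
    if "total_degree P = r" for P
  proof -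
    have "P = (r - snd P, snd P)" using that by (cases P) (simp add: total_degree_def)
    then have "P \<in> (\<lambda>s. (r - s, s)) ` X \<longleftrightarrow> snd P \<in> X" for X
      by (auto intro: image_eqI[of _ _ "snd P"])
    from this[of "jump r n p ` {1..n}"] show ?thesis by (simp add: image_image)
  qed
  ultimately show ?thesis unfolding staircase_of_def by auto
qed

lemma staircase_staircase_of: "staircase (staircase_of r n p)"
proof -
  have "P \<in> staircase_of r n p" if "P + R \<in> staircase_of r n p" for P R
  proof (cases "R = 0")
    case False
    then have "mono_divides P (P + R)" "P \<noteq> P + R" by (auto simp: mono_divides_def)
    then have "total_degree P < r"
      using mono_divides_degree that by (fastforce simp: staircase_of_alt)
    then show ?thesis by (simp add: staircase_of_alt)
  qed (use that in auto)
  then show ?thesis by (auto simp: staircase_def)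
qed

lemma degree_slice_staircase_of:
  "degree_slice (staircase_of r n p) r = {..r} - jump r n p ` {1..n}"
  by (auto simp: degree_slice_def staircase_of_alt total_degree_def)

text \<open>
  The reflection of the box sends degree \<open>e\<close> to degree \<open>M + N - 2 - e\<close>. So the dual contains every
  monomial of the box of degree below \<open>M + N - 2 - r\<close>, nothing above that degree, and in that degree
  the reflections of the removed monomials.
\<close>

lemma mem_dual_iff:
  "P \<in> dual_staircase M N (staircase_of r n p) \<longleftrightarrow>
    fst P < M \<and> snd P < N \<and> r + total_degree P + 2 \<le> M + N \<and>
    (r + total_degree P + 2 = M + N \<longrightarrow> N - 1 - snd P \<in> jump r n p ` {1..n})"
proof (cases "fst P < M \<and> snd P < N")
  case True
  define t where "t = (M - 1 - fst P) + (N - 1 - snd P)"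
  have t: "r + (t + total_degree P + 2) = r + (M + N)"
    using True unfolding t_def total_degree_def by linarith
  have "P \<in> dual_staircase M N (staircase_of r n p) \<longleftrightarrow>
      \<not> (t \<le> r \<and> (t = r \<longrightarrow> N - 1 - snd P \<notin> jump r n p ` {1..n}))"
    using True
    by (cases P) (simp only: dual_staircase_def box_def staircase_of_alt t_def total_degree_def
      mem_Collect_eq case_prod_conv fst_conv snd_conv simp_thms)
  moreover have "t \<le> r \<longleftrightarrow> M + N \<le> r + total_degree P + 2" "t = r \<longleftrightarrow> r + total_degree P + 2 = M + N"
    using t by linarith+
  ultimately show ?thesis using True by linarith
next
  case False
  then have "P \<notin> box M N" by (auto simp: box_def)
  then have "P \<notin> dual_staircase M N (staircase_of r n p)" by (auto simp: dual_staircase_def)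
  with False show ?thesis by blast
qed

lemma staircase_dual: "staircase (dual_staircase M N (staircase_of r n p))"
proof -
  have "P \<in> dual_staircase M N (staircase_of r n p)"
    if *: "P + R \<in> dual_staircase M N (staircase_of r n p)" for P R
  proof (cases "R = 0")
    case False
    then have "mono_divides P (P + R)" "P \<noteq> P + R" by (auto simp: mono_divides_def)
    then have "total_degree P < total_degree (P + R)" by (rule mono_divides_degree)
    then show ?thesis using * by (auto simp: mem_dual_iff)
  qed (use that in auto)
  then show ?thesis by (auto simp: staircase_def)
qed

text \<open>
  A removed monomial of degree \<open>r\<close> can lie outside the box, as \<open>x\<^sup>r\<close> does for \<open>M = r\<close>. Such a
  monomial leaves no trace in the dual.
\<close>

definition box_jumps :: "nat \<Rightarrow> nat \<Rightarrow> nat set" where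
  "box_jumps M N = {s \<in> jump r n p ` {1..n}. s < N \<and> r - s < M}"

lemma degree_slice_dual:
  "degree_slice (dual_staircase M N (staircase_of r n p)) (M + N - 2 - r)
     = (\<lambda>s. N - 1 - s) ` box_jumps M N"
  \<comment> \<open>If the subtraction on the left truncates, then both sides are empty.\<close>
proof (rule equalityI; rule subsetI)
  fix y assume y: "y \<in> degree_slice (dual_staircase M N (staircase_of r n p)) (M + N - 2 - r)"
  let ?d = "M + N - 2 - r"
  have *: "y \<le> ?d" "?d - y < M" "y < N" "r + ?d + 2 \<le> M + N"
    and **: "r + ?d + 2 = M + N \<longrightarrow> N - 1 - y \<in> jump r n p ` {1..n}"
    using y by (simp_all only: degree_slice_def mem_dual_iff total_degree_def mem_Collect_eq
      fst_conv snd_conv) linarith+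
  then have "r + ?d + 2 = M + N" by linarith
  then have "N - 1 - y \<in> jump r n p ` {1..n}" "N - 1 - y < N" "r - (N - 1 - y) < M"
    using * ** by auto
  then have "N - 1 - y \<in> box_jumps M N" by (simp only: box_jumps_def mem_Collect_eq simp_thms)
  moreover have "y = N - 1 - (N - 1 - y)" using * by simp
  ultimately show "y \<in> (\<lambda>s. N - 1 - s) ` box_jumps M N" by blast
next
  fix y assume "y \<in> (\<lambda>s. N - 1 - s) ` box_jumps M N"
  then obtain s where s: "y = N - 1 - s" "s \<in> jump r n p ` {1..n}" "s < N" "r - s < M"
    by (auto simp: box_jumps_def)
  let ?d = "M + N - 2 - r"
  have "s \<le> r" using s(2) jumps_subset by auto
  then have sum: "r + ?d + 2 = M + N" using s(3,4) by linarith
  have reflect: "N - 1 - y = s" using s by simp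
  have le: "y \<le> ?d" and bounds: "?d - y < M" "y < N"
    using s(1,3,4) sum \<open>s \<le> r\<close> by linarith+
  have "(?d - y, y) \<in> dual_staircase M N (staircase_of r n p)"
    unfolding mem_dual_iff using le bounds sum reflect s(2) by (simp add: total_degree_def)
  then show "y \<in> degree_slice (dual_staircase M N (staircase_of r n p)) ?d"
    using le by (simp add: degree_slice_def)
qed

end

section \<open>Coordinates, dimensions and minors\<close>

text \<open>
  The coefficient of \<open>f\<close> at the \<open>s\<close>-th smallest monomial of degree \<open>r\<close>, counted from \<open>0\<close>.
\<close>

definition coord :: "nat \<Rightarrow> nat \<Rightarrow> 'k::field kxy \<Rightarrow> 'k" where
  "coord r s f = Poly_Mapping.lookup f (r - s, s)"

lemma coord_0 [simp]: "coord r s 0 = 0"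
  and coord_add [simp]: "coord r s (f + g) = coord r s f + coord r s g"
  and coord_scale [simp]: "coord r s (kxy_scale c f) = c * coord r s f"
  by (simp_all add: coord_def lookup_add lookup_kxy_scale)

lemma coord_sum: "coord r s (sum f A) = (\<Sum>i\<in>A. coord r s (f i))"
  by (induction A rule: infinite_finite_induct) simp_all

lemma coord_monomial [simp]:
  "coord r s (Poly_Mapping.single (r - u, u) c) = (if s = u then c else 0)"
  by (simp add: coord_def lookup_single when_def)

lemma homogeneous_iff:
  "f \<in> homogeneous r \<longleftrightarrow> (\<forall>P. total_degree P \<noteq> r \<longrightarrow> Poly_Mapping.lookup f P = 0)"
  by (auto simp: homogeneous_def in_keys_iff)

lemma homogeneous_eqI:
  assumes "f \<in> homogeneous r" "g \<in> homogeneous r" "\<And>s. s \<le> r \<Longrightarrow> coord r s f = coord r s g"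
  shows "f = g"
proof (rule poly_mapping_eqI)
  fix P
  show "Poly_Mapping.lookup f P = Poly_Mapping.lookup g P"
  proof (cases "total_degree P = r")
    case True
    then have "P = (r - snd P, snd P)" "snd P \<le> r" by (auto simp: total_degree_def prod_eq_iff)
    then show ?thesis using assms(3)[of "snd P"] by (simp add: coord_def)
  next
    case False
    then show ?thesis using assms(1,2) unfolding homogeneous_iff by metis
  qed
qed

lemma subspace_homogeneous: "kxy.subspace (homogeneous r)"
  by (rule kxy.subspaceI) (simp_all add: homogeneous_iff lookup_add lookup_kxy_scale)

lemma monomial_homogeneous: "s \<le> r \<Longrightarrow> Poly_Mapping.single (r - s, s) c \<in> homogeneous r"
  by (auto simp: homogeneous_iff lookup_single when_def total_degree_def)

lemma homogeneous_expansion: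
  assumes f: "f \<in> homogeneous r" and J: "finite J" "J \<subseteq> {..r}"
    and zero: "\<And>s. s \<le> r \<Longrightarrow> s \<notin> J \<Longrightarrow> coord r s f = 0"
  shows "f = (\<Sum>s\<in>J. kxy_scale (coord r s f) (Poly_Mapping.single (r - s, s) 1))"
proof (rule homogeneous_eqI[OF f])
  show "(\<Sum>s\<in>J. kxy_scale (coord r s f) (Poly_Mapping.single (r - s, s) 1)) \<in> homogeneous r"
    using J by (intro kxy.subspace_sum kxy.subspace_scale subspace_homogeneous monomial_homogeneous) auto
  fix s assume "s \<le> r"
  then show "coord r s f = coord r s (\<Sum>s\<in>J. kxy_scale (coord r s f) (Poly_Mapping.single (r - s, s) 1))"
    using J zero by (simp add: coord_sum if_distrib cong: if_cong)
qed

lemma mem_flag_iff: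
  assumes "j \<le> r + 1"
  shows "f \<in> flag r j \<longleftrightarrow> f \<in> homogeneous r \<and> (\<forall>s\<le>r. j \<le> s \<longrightarrow> coord r s f = 0)"
proof
  let ?U = "{f. f \<in> homogeneous r \<and> (\<forall>s\<le>r. j \<le> s \<longrightarrow> coord r s f = 0)}"
  have "kxy.subspace ?U"
    using subspace_homogeneous[of r] by (intro kxy.subspaceI) (auto simp: kxy.subspace_def)
  moreover have "(\<lambda>s. Poly_Mapping.single (r - s, s) 1) ` {..<j} \<subseteq> ?U"
    using assms by (auto intro: monomial_homogeneous)
  moreover assume "f \<in> flag r j"
  ultimately have "f \<in> ?U" unfolding flag_def using kxy.span_minimal by blast
  then show "f \<in> homogeneous r \<and> (\<forall>s\<le>r. j \<le> s \<longrightarrow> coord r s f = 0)" by simp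
next
  assume "f \<in> homogeneous r \<and> (\<forall>s\<le>r. j \<le> s \<longrightarrow> coord r s f = 0)"
  then have "f = (\<Sum>s\<in>{..<j}. kxy_scale (coord r s f) (Poly_Mapping.single (r - s, s) 1))"
    using assms by (intro homogeneous_expansion) auto
  also have "\<dots> \<in> flag r j"
    unfolding flag_def by (intro kxy.span_sum kxy.span_scale kxy.span_base) auto
  finally show "f \<in> flag r j" .
qed

lemma homogeneous_eq_flag: "homogeneous r = flag r (r + 1)"
  by (auto simp: mem_flag_iff)

lemma finite_independent_homogeneous:
  assumes "kxy.independent B" "B \<subseteq> homogeneous r"
  shows "finite B"
  using assms kxy.independent_span_bound[of _ B] unfolding homogeneous_eq_flag flag_def by blast

lemma span_family:
  assumes "finite I" and "inj_on b I" and "w \<in> kxy.span (b ` I)"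
  obtains c where "w = (\<Sum>i\<in>I. kxy_scale (c i) (b i))"
proof -
  obtain u where "w = (\<Sum>v\<in>b ` I. kxy_scale (u v) v)"
    using assms kxy.span_finite[of "b ` I"] by auto
  then have "w = (\<Sum>i\<in>I. kxy_scale (u (b i)) (b i))" using assms(2) by (simp add: sum.reindex)
  then show ?thesis by (rule that)
qed

lemma independent_family_iff:
  assumes "finite I" and "inj_on b I"
  shows "kxy.independent (b ` I) \<longleftrightarrow>
    (\<forall>c. (\<Sum>i\<in>I. kxy_scale (c i) (b i)) = 0 \<longrightarrow> (\<forall>i\<in>I. c i = 0))"
proof -
  have reindex: "(\<Sum>v\<in>b ` I. kxy_scale (u v) v) = (\<Sum>i\<in>I. kxy_scale (u (b i)) (b i))" for u
    using assms(2) by (simp add: sum.reindex)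
  have "kxy.independent (b ` I) \<longleftrightarrow>
      (\<forall>u. (\<Sum>i\<in>I. kxy_scale (u (b i)) (b i)) = 0 \<longrightarrow> (\<forall>i\<in>I. u (b i) = 0))"
    using assms(1) by (subst kxy.dependent_finite) (auto simp: reindex)
  also have "\<dots> \<longleftrightarrow> (\<forall>c. (\<Sum>i\<in>I. kxy_scale (c i) (b i)) = 0 \<longrightarrow> (\<forall>i\<in>I. c i = 0))"
  proof (intro iffI allI impI)
    fix c
    assume *: "\<forall>u. (\<Sum>i\<in>I. kxy_scale (u (b i)) (b i)) = 0 \<longrightarrow> (\<forall>i\<in>I. u (b i) = 0)"
      and zero: "(\<Sum>i\<in>I. kxy_scale (c i) (b i)) = 0"
    define u where "u = c \<circ> inv_into I b"
    have u: "u (b i) = c i" if "i \<in> I" for i using that assms(2) by (simp add: u_def)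
    have "(\<Sum>i\<in>I. kxy_scale (u (b i)) (b i)) = 0" using zero u by simp
    then have "\<forall>i\<in>I. u (b i) = 0" using * by blast
    then show "\<forall>i\<in>I. c i = 0" using u by simp
  next
    fix u
    assume *: "\<forall>c. (\<Sum>i\<in>I. kxy_scale (c i) (b i)) = 0 \<longrightarrow> (\<forall>i\<in>I. c i = 0)"
      and zero: "(\<Sum>i\<in>I. kxy_scale (u (b i)) (b i)) = 0"
    show "\<forall>i\<in>I. u (b i) = 0" using *[rule_format, of "\<lambda>i. u (b i)"] zero by blast
  qed
  finally show ?thesis .
qed

text \<open>
  The projection to the coordinates in \<open>J\<close> embeds \<open>U\<close> into a space of dimension \<open>card J\<close>.
\<close>

lemma dim_le_card_coords:
  assumes U: "kxy.subspace U" "U \<subseteq> homogeneous r" and J: "finite J"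
    and inj: "\<And>w. w \<in> U \<Longrightarrow> (\<And>s. s \<in> J \<Longrightarrow> coord r s w = 0) \<Longrightarrow> w = 0"
  shows "kxy.dim U \<le> card J"
proof -
  interpret vector_space_pair "kxy_scale :: 'a \<Rightarrow> 'a kxy \<Rightarrow> 'a kxy" "kxy_scale :: 'a \<Rightarrow> 'a kxy \<Rightarrow> 'a kxy"
    by unfold_locales
  define mon :: "nat \<Rightarrow> 'a kxy" where "mon s = Poly_Mapping.single (r - s, s) 1" for s
  define \<pi> where "\<pi> w = (\<Sum>s\<in>J. kxy_scale (coord r s w) (mon s))" for w
  have lin: "Vector_Spaces.linear kxy_scale kxy_scale \<pi>"
    by unfold_locales
       (simp_all add: \<pi>_def kxy.scale_left_distrib sum.distrib kxy.scale_sum_right)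
  have coord_\<pi>: "coord r s (\<pi> w) = coord r s w" if "s \<in> J" for s w
    using that J by (simp add: \<pi>_def mon_def coord_sum if_distrib cong: if_cong)
  obtain B where B: "B \<subseteq> U" "kxy.independent B" "U \<subseteq> kxy.span B" "card B = kxy.dim U"
    using kxy.basis_exists[of U] by metis
  have span: "kxy.span B \<subseteq> U" using B(1) U(1) by (rule kxy.span_minimal)
  have inj\<pi>: "inj_on \<pi> (kxy.span B)"
    unfolding linear_inj_on_iff_eq_0[OF lin kxy.subspace_span]
  proof (intro ballI impI)
    fix w assume w: "w \<in> kxy.span B" "\<pi> w = 0"
    then have "coord r s w = 0" if "s \<in> J" for s using coord_\<pi>[OF that, of w] by simp
    then show "w = 0" using inj w(1) span by blast
  qed
  have "kxy.independent (\<pi> ` B)"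
    by (rule linear_independent_injective_image[OF lin B(2) inj\<pi>])
  moreover have "\<pi> ` B \<subseteq> kxy.span (mon ` J)"
    unfolding \<pi>_def by (intro image_subsetI kxy.span_sum kxy.span_scale kxy.span_base imageI)
  ultimately have "card (\<pi> ` B) \<le> card (mon ` J)"
    using kxy.independent_span_bound J by blast
  moreover have "inj_on \<pi> B" using inj\<pi> kxy.span_superset by (rule inj_on_subset)
  ultimately show ?thesis using B(4) card_image_le[OF J, of mon] by (simp add: card_image)
qed

lemma subspace_eq_of_dim_eq:
  assumes U: "kxy.subspace U" and sub: "U \<subseteq> V" and V: "V \<subseteq> homogeneous r"
    and dim: "kxy.dim U = kxy.dim V"
  shows "U = V"
proof (rule ccontr)
  assume "U \<noteq> V"
  then obtain w where w: "w \<in> V" "w \<notin> U" using sub by auto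
  obtain B where B: "B \<subseteq> U" "kxy.independent B" "U \<subseteq> kxy.span B" "card B = kxy.dim U"
    using kxy.basis_exists[of U] by metis
  obtain C where C: "C \<subseteq> V" "kxy.independent C" "V \<subseteq> kxy.span C" "card C = kxy.dim V"
    using kxy.basis_exists[of V] by metis
  have "B \<subseteq> homogeneous r" "C \<subseteq> homogeneous r" using B(1) C(1) sub V by blast+
  then have "finite B" "finite C"
    using B(2) C(2) by (simp_all add: finite_independent_homogeneous)
  have "w \<notin> kxy.span B" using w(2) kxy.span_minimal[OF B(1) U] by blast
  then have "kxy.independent (insert w B)" using B(2) by (rule kxy.independent_insertI)
  moreover have "insert w B \<subseteq> kxy.span C" using w(1) B(1) sub C(3) by blast
  ultimately have "card (insert w B) \<le> card C"
    using kxy.independent_span_bound \<open>finite C\<close> by blast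
  moreover have "w \<notin> B" using w(2) B(1) by blast
  ultimately show False using \<open>finite B\<close> B(4) C(4) dim by simp
qed

lemma ordered_basis_exists:
  assumes "W \<in> grassmannian n r"
  obtains B where "ordered_basis B W"
proof -
  have W: "kxy.subspace W" "W \<subseteq> homogeneous r" using assms by (auto simp: grassmannian_def)
  obtain X where X: "X \<subseteq> W" "kxy.independent X" "W \<subseteq> kxy.span X"
    using kxy.basis_exists[of W] by metis
  then have "finite X" using W finite_independent_homogeneous by blast
  then obtain B where "set B = X" "distinct B" using finite_distinct_list by blast
  then show ?thesis
    using that X kxy.span_minimal[OF X(1) W(1)] unfolding ordered_basis_def by blast
qed

lemma length_ordered_basis:
  assumes "W \<in> grassmannian n r" and "ordered_basis B W"
  shows "length B = n"
proof -
  have "kxy.dim W = card (set B)"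
    using assms(2) kxy.dim_span_eq_card_independent[of "set B"] by (auto simp: ordered_basis_def)
  then show ?thesis using assms by (simp add: grassmannian_def ordered_basis_def distinct_card)
qed

text \<open>
  The minor at \<open>I\<close> is the determinant of the projection of \<open>W\<close> to the coordinates in \<open>I\<close>: a kernel
  vector of the transposed matrix is the list of coefficients of a vector of \<open>W\<close> that vanishes on
  \<open>I\<close>. This translates all the questions about Pluecker coordinates into questions about vectors,
  and it shows that the vanishing does not depend on the basis.
\<close>

lemma pluecker_eq_0_iff:
  assumes W: "W \<in> grassmannian n r" and B: "ordered_basis B W" and I: "I \<in> pluecker_index n r"
  shows "pluecker n r B I = 0 \<longleftrightarrow> (\<exists>w\<in>W. w \<noteq> 0 \<and> (\<forall>s\<in>I. coord r s w = 0))"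
proof -
  define A where "A = Matrix.mat n n (\<lambda>(a, b). coord r (sorted_list_of_set I ! b) (B ! a))"
  define comb where "comb v = (\<Sum>a\<in>{..<n}. kxy_scale (v a) (B ! a))" for v
  have A: "A \<in> carrier_mat n n" by (simp add: A_def)
  have len: "length B = n" using W B by (rule length_ordered_basis)
  then have set_B: "set B = (!) B ` {..<n}" by (auto simp: set_conv_nth)
  have inj: "inj_on ((!) B) {..<n}"
    using B len by (auto simp: ordered_basis_def intro: inj_on_nth)
  have indep: "v a = 0" if "comb v = 0" "a < n" for v a
    using B that independent_family_iff[OF _ inj] by (auto simp: ordered_basis_def set_B comb_def)
  have "comb v \<in> kxy.span (set B)" for v
    unfolding comb_def using len by (intro kxy.span_sum kxy.span_scale kxy.span_base) auto
  then have comb_in: "comb v \<in> W" for v using B by (simp add: ordered_basis_def)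
  have finI: "finite I" using I finite_subset by (auto simp: pluecker_index_def)
  have I_enum: "I = (!) (sorted_list_of_set I) ` {..<n}"
  proof -
    have "I = set (sorted_list_of_set I)" using finI by simp
    also have "\<dots> = (!) (sorted_list_of_set I) ` {..<length (sorted_list_of_set I)}"
      by (auto simp: set_conv_nth)
    finally show ?thesis using I by (simp add: pluecker_index_def)
  qed
  have "pluecker n r B I = Determinant.det A"
    by (simp add: pluecker_def A_def coord_def Let_def)
  also have "\<dots> = Determinant.det (transpose_mat A)" using A by (simp add: det_transpose)
  finally have det: "pluecker n r B I = Determinant.det (transpose_mat A)" .
  have entry: "(transpose_mat A *\<^sub>v v) $ b = coord r (sorted_list_of_set I ! b) (comb (($) v))"
    if "v \<in> carrier_vec n" "b < n" for v b
    using that by (simp add: A_def comb_def scalar_prod_def coord_sum mult.commute lessThan_atLeast0)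
  have kernel: "transpose_mat A *\<^sub>v v = 0\<^sub>v n \<longleftrightarrow> (\<forall>s\<in>I. coord r s (comb (($) v)) = 0)"
    if "v \<in> carrier_vec n" for v
  proof -
    have "transpose_mat A *\<^sub>v v = 0\<^sub>v n \<longleftrightarrow> (\<forall>b<n. (transpose_mat A *\<^sub>v v) $ b = 0)"
      using A by (auto simp: vec_eq_iff)
    also have "\<dots> \<longleftrightarrow> (\<forall>s\<in>I. coord r s (comb (($) v)) = 0)"
      using entry[OF that] by (subst I_enum) auto
    finally show ?thesis .
  qed
  have "pluecker n r B I = 0 \<longleftrightarrow>
      (\<exists>v. v \<in> carrier_vec n \<and> v \<noteq> 0\<^sub>v n \<and> transpose_mat A *\<^sub>v v = 0\<^sub>v n)"
    unfolding det using A by (intro det_0_iff_vec_prod_zero_field) simp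
  also have "\<dots> \<longleftrightarrow> (\<exists>w\<in>W. w \<noteq> 0 \<and> (\<forall>s\<in>I. coord r s w = 0))"
  proof
    assume "\<exists>v. v \<in> carrier_vec n \<and> v \<noteq> 0\<^sub>v n \<and> transpose_mat A *\<^sub>v v = 0\<^sub>v n"
    then obtain v where v: "v \<in> carrier_vec n" "v \<noteq> 0\<^sub>v n" "\<forall>s\<in>I. coord r s (comb (($) v)) = 0"
      using kernel by blast
    have "comb (($) v) \<noteq> 0"
    proof
      assume "comb (($) v) = 0"
      then have "v = 0\<^sub>v n" using v(1) indep by (intro eq_vecI) auto
      then show False using v(2) by simp
    qed
    then show "\<exists>w\<in>W. w \<noteq> 0 \<and> (\<forall>s\<in>I. coord r s w = 0)" using comb_in v(3) by blast
  next
    assume "\<exists>w\<in>W. w \<noteq> 0 \<and> (\<forall>s\<in>I. coord r s w = 0)"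
    then obtain w where w: "w \<in> W" "w \<noteq> 0" "\<forall>s\<in>I. coord r s w = 0" by blast
    have "w \<in> kxy.span ((!) B ` {..<n})" using w(1) B by (simp add: ordered_basis_def set_B)
    then obtain c where c: "w = comb c" using span_family[OF _ inj] unfolding comb_def by blast
    define v where "v = Matrix.vec n c"
    have "comb (($) v) = w" by (simp add: c comb_def v_def)
    moreover have "v \<noteq> 0\<^sub>v n" using calculation w(2) by (auto simp: comb_def)
    ultimately show "\<exists>v. v \<in> carrier_vec n \<and> v \<noteq> 0\<^sub>v n \<and> transpose_mat A *\<^sub>v v = 0\<^sub>v n"
      using w(3) kernel[of v] by (intro exI[of _ v]) (auto simp: v_def)
  qed
  finally show ?thesis .
qed

section \<open>Vectors and bases of the points of a Schubert cell\<close>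

context admissible_sequence
begin

lemma jump_index: "jump r n p ` {1..n} \<in> pluecker_index n r"
  using jump_le jump_inj by (auto simp: pluecker_index_def card_image)

lemma schubert_cell_iff:
  "W \<in> schubert_cell r n p \<longleftrightarrow> W \<in> grassmannian n r \<and>
    (\<forall>i\<le>n. \<forall>j\<le>r + 1. (0 < i \<longrightarrow> jump r n p i < j) \<and> (i < n \<longrightarrow> j \<le> jump r n p (i + 1)) \<longrightarrow>
       kxy.dim (W \<inter> flag r j) = i)"
proof -
  have lower: "r + 1 - n + i - p i \<le> j \<longleftrightarrow> jump r n p i < j" if "0 < i" "i \<le> n" for i j
    using jump_add[of i] entry_le[of i] that n_le by auto
  have upper: "j < r + 1 - n + (i + 1) - p (i + 1) \<longleftrightarrow> j \<le> jump r n p (i + 1)" if "i < n" for i j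
    using jump_add[of "i + 1"] entry_le[of "i + 1"] that n_le by auto
  show ?thesis
    unfolding schubert_cell_def using lower upper by (auto simp: le_less)
qed

lemma cell_inter_flag_dim:
  assumes W: "W \<in> schubert_cell r n p" and "i \<le> n" "j \<le> r + 1"
    and "0 < i \<Longrightarrow> jump r n p i < j" "i < n \<Longrightarrow> j \<le> jump r n p (i + 1)"
  shows "kxy.dim (W \<inter> flag r j) = i"
proof -
  have "\<forall>i\<le>n. \<forall>j\<le>r + 1. (0 < i \<longrightarrow> jump r n p i < j) \<and> (i < n \<longrightarrow> j \<le> jump r n p (i + 1)) \<longrightarrow>
      kxy.dim (W \<inter> flag r j) = i"
    using W unfolding schubert_cell_iff by (rule conjunct2)
  from this[rule_format, of i j] show ?thesis using assms(2-5) by blast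
qed

lemma cell_flag_dim:
  assumes "W \<in> schubert_cell r n p" and i: "i \<in> {1..n}"
  shows "kxy.dim (W \<inter> flag r (Suc (jump r n p i))) = i"
proof -
  have "Suc (jump r n p i) \<le> jump r n p (i + 1)" if "i < n"
    using strict_mono_onD[OF jump_strict_mono i, of "i + 1"] that by simp
  moreover have "Suc (jump r n p i) \<le> r + 1" using jump_le[OF i] by simp
  ultimately show ?thesis using i by (intro cell_inter_flag_dim[OF assms(1)]) auto
qed

lemma exists_jump_index:
  obtains i where "i \<le> n" "0 < i \<Longrightarrow> jump r n p i < j" "i < n \<Longrightarrow> j \<le> jump r n p (i + 1)"
proof -
  define K where "K = insert 0 {k\<in>{1..n}. jump r n p k < j}"
  define i where "i = Max K"
  have fin: "finite K" by (simp add: K_def)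
  have "i \<in> K" unfolding i_def using fin by (intro Max_in) (auto simp: K_def)
  have "i + 1 \<notin> K" using Max_ge[OF fin, of "i + 1"] by (auto simp: i_def)
  show ?thesis
    using \<open>i \<in> K\<close> \<open>i + 1 \<notin> K\<close> by (intro that[of i]) (auto simp: K_def)
qed

text \<open>
  The highest nonzero coordinate of a nonzero vector of \<open>W\<close> sits at a jump. At any other index \<open>j\<close>
  the spaces \<open>W \<inter> V\<^sub>j\<close> and \<open>W \<inter> V\<^bsub>j+1\<^esub>\<close> have the same dimension, so they are equal and
  no vector of \<open>W\<close> has its highest coordinate at \<open>j\<close>.
\<close>

lemma cell_vanishing_on_jumps:
  assumes W: "W \<in> schubert_cell r n p" and w: "w \<in> W"
    and zero: "\<And>s. s \<in> jump r n p ` {1..n} \<Longrightarrow> coord r s w = 0"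
  shows "w = 0"
proof (rule ccontr)
  assume "w \<noteq> 0"
  have sub: "kxy.subspace W" and hom: "W \<subseteq> homogeneous r"
    using W by (auto simp: schubert_cell_iff grassmannian_def)
  define Z where "Z = {s. s \<le> r \<and> coord r s w \<noteq> 0}"
  have "finite Z" by (simp add: Z_def)
  have "Z \<noteq> {}"
  proof
    assume "Z = {}"
    then have "w = 0"
      using w hom kxy.subspace_0[OF subspace_homogeneous]
      by (intro homogeneous_eqI[of w r 0]) (auto simp: Z_def)
    then show False using \<open>w \<noteq> 0\<close> by simp
  qed
  define j where "j = Max Z"
  have j: "j \<le> r" "coord r j w \<noteq> 0"
    using Max_in[OF \<open>finite Z\<close> \<open>Z \<noteq> {}\<close>] by (auto simp: Z_def j_def)
  have above: "coord r s w = 0" if "s \<le> r" "Suc j \<le> s" for s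
    using Max_ge[OF \<open>finite Z\<close>, of s] that by (fastforce simp: Z_def j_def)
  have not_jump: "j \<noteq> jump r n p i" if "i \<in> {1..n}" for i using zero j(2) that by blast
  obtain i where i: "i \<le> n" "0 < i \<Longrightarrow> jump r n p i < j" "i < n \<Longrightarrow> j \<le> jump r n p (i + 1)"
    by (rule exists_jump_index[of j]) blast
  have "Suc j \<le> jump r n p (i + 1)" if "i < n"
    using i(3)[OF that] not_jump[of "i + 1"] that by simp
  then have "kxy.dim (W \<inter> flag r (Suc j)) = i"
    using i j(1) by (intro cell_inter_flag_dim[OF W]) auto
  moreover have "kxy.dim (W \<inter> flag r j) = i"
    using i j(1) by (intro cell_inter_flag_dim[OF W]) auto
  moreover have "flag r j \<subseteq> (flag r (Suc j) :: 'a kxy set)"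
    using j(1) by (auto simp: mem_flag_iff)
  moreover have "kxy.subspace (W \<inter> flag r j)"
    using sub by (auto simp: flag_def intro: kxy.subspace_inter)
  ultimately have "W \<inter> flag r j = W \<inter> flag r (Suc j)"
    using hom by (intro subspace_eq_of_dim_eq[of _ _ r]) auto
  moreover have "w \<in> W \<inter> flag r (Suc j)" "w \<notin> flag r j"
    using w hom above j by (auto simp: mem_flag_iff)
  ultimately show False by blast
qed

lemma cell_pluecker_nonzero:
  assumes "W \<in> schubert_cell r n p" and "ordered_basis B W"
  shows "pluecker n r B (jump r n p ` {1..n}) \<noteq> 0"
proof -
  have "W \<in> grassmannian n r" using assms(1) by (simp add: schubert_cell_iff)
  then show ?thesis
    using pluecker_eq_0_iff[OF _ assms(2) jump_index] cell_vanishing_on_jumps[OF assms(1)] by blast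
qed

text \<open>
  The vectors \<open>b 1, \<dots>, b n\<close> form an echelon basis with the pivots (the highest nonzero
  coordinates) at the jumps. Such bases produce points of the Schubert cell.
\<close>

definition echelon :: "(nat \<Rightarrow> 'k::field kxy) \<Rightarrow> bool" where
  "echelon b \<longleftrightarrow> (\<forall>i\<in>{1..n}. b i \<in> homogeneous r \<and> coord r (jump r n p i) (b i) \<noteq> 0 \<and>
     (\<forall>u\<le>r. jump r n p i < u \<longrightarrow> coord r u (b i) = 0))"

lemma echelonD:
  assumes "echelon b" "i \<in> {1..n}"
  shows "b i \<in> homogeneous r" "coord r (jump r n p i) (b i) \<noteq> 0"
    "\<And>u. u \<le> r \<Longrightarrow> jump r n p i < u \<Longrightarrow> coord r u (b i) = 0"
  using assms by (auto simp: echelon_def)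

text \<open>
  In a linear combination of echelon vectors the pivot of the last vector that occurs cannot cancel.
\<close>

lemma echelon_coefficients_vanish:
  assumes b: "echelon b" and i: "i \<in> {1..n}" "j \<le> jump r n p i"
    and w: "\<And>u. u \<le> r \<Longrightarrow> j \<le> u \<Longrightarrow> coord r u (\<Sum>k\<in>{1..n}. kxy_scale (c k) (b k)) = 0"
  shows "c i = 0"
proof (rule ccontr)
  assume "c i \<noteq> 0"
  define Z where "Z = {k\<in>{1..n}. j \<le> jump r n p k \<and> c k \<noteq> 0}"
  have Z: "finite Z" "Z \<noteq> {}" using i \<open>c i \<noteq> 0\<close> by (auto simp: Z_def)
  define m where "m = Max Z"
  have m: "m \<in> {1..n}" "j \<le> jump r n p m" "c m \<noteq> 0"
    using Max_in[OF Z] by (auto simp: Z_def m_def)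
  have others: "c k * coord r (jump r n p m) (b k) = 0" if k: "k \<in> {1..n} - {m}" for k
  proof (cases "k < m")
    case True
    then have "jump r n p k < jump r n p m" using strict_mono_onD[OF jump_strict_mono _ m(1)] k by blast
    then show ?thesis using echelonD(3)[OF b, of k] jump_le[OF m(1)] k by simp
  next
    case False
    then have "m < k" using k by auto
    then have "jump r n p m < jump r n p k" using strict_mono_onD[OF jump_strict_mono m(1)] k by blast
    moreover have "k \<notin> Z" using Max_ge[OF Z(1), of k] \<open>m < k\<close> by (auto simp: m_def)
    ultimately show ?thesis using k m(2) by (auto simp: Z_def)
  qed
  have "0 = coord r (jump r n p m) (\<Sum>k\<in>{1..n}. kxy_scale (c k) (b k))"
    using w[of "jump r n p m"] jump_le[OF m(1)] m(2) by simp
  also have "\<dots> = (\<Sum>k\<in>{1..n}. c k * coord r (jump r n p m) (b k))" by (simp add: coord_sum)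
  also have "\<dots> = c m * coord r (jump r n p m) (b m)"
    using sum.remove[OF _ m(1), of "\<lambda>k. c k * coord r (jump r n p m) (b k)"]
      sum.neutral[of "{1..n} - {m}", OF ballI[OF others]] by simp
  finally show False using m(3) echelonD(2)[OF b m(1)] by simp
qed

lemma echelon_inj: "echelon b \<Longrightarrow> inj_on b {1..n}"
proof (rule linorder_inj_onI')
  fix i k assume b: "echelon b" and *: "i \<in> {1..n}" "k \<in> {1..n}" "i < k"
  have "coord r (jump r n p k) (b i) = 0"
    using echelonD(3)[OF b *(1)] jump_le[OF *(2)] strict_mono_onD[OF jump_strict_mono *] by simp
  then show "b i \<noteq> b k" using echelonD(2)[OF b *(2)] by auto
qed

lemma echelon_independent: "echelon b \<Longrightarrow> kxy.independent (b ` {1..n})"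
proof (subst independent_family_iff)
  assume b: "echelon b"
  then show "inj_on b {1..n}" by (rule echelon_inj)
  show "\<forall>c. (\<Sum>i\<in>{1..n}. kxy_scale (c i) (b i)) = 0 \<longrightarrow> (\<forall>i\<in>{1..n}. c i = 0)"
    using echelon_coefficients_vanish[OF b, of _ 0] by auto
qed simp

lemma echelon_inter_flag:
  assumes b: "echelon b" and j: "j \<le> r + 1"
  shows "kxy.span (b ` {1..n}) \<inter> flag r j = kxy.span (b ` {i\<in>{1..n}. jump r n p i < j})"
proof (rule equalityI)
  let ?K = "{i\<in>{1..n}. jump r n p i < j}"
  show "kxy.span (b ` {1..n}) \<inter> flag r j \<subseteq> kxy.span (b ` ?K)"
  proof
    fix w assume w: "w \<in> kxy.span (b ` {1..n}) \<inter> flag r j"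
    then obtain c where c: "w = (\<Sum>k\<in>{1..n}. kxy_scale (c k) (b k))"
      using span_family[OF _ echelon_inj[OF b]] by blast
    have "coord r u w = 0" if "u \<le> r" "j \<le> u" for u
      using w that by (simp add: mem_flag_iff[OF j])
    then have "c k = 0" if "k \<in> {1..n}" "j \<le> jump r n p k" for k
      using echelon_coefficients_vanish[OF b that] unfolding c by blast
    then have "w = (\<Sum>k\<in>?K. kxy_scale (c k) (b k))"
      unfolding c by (intro sum.mono_neutral_right) (auto simp: not_less)
    also have "\<dots> \<in> kxy.span (b ` ?K)"
      by (intro kxy.span_sum kxy.span_scale kxy.span_base imageI)
    finally show "w \<in> kxy.span (b ` ?K)" .
  qed
  have "b ` ?K \<subseteq> flag r j"
    using echelonD(1,3)[OF b] by (auto simp: mem_flag_iff[OF j])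
  then have "kxy.span (b ` ?K) \<subseteq> flag r j"
    by (rule kxy.span_minimal) (simp add: flag_def)
  moreover have "kxy.span (b ` ?K) \<subseteq> kxy.span (b ` {1..n})" by (rule kxy.span_mono) auto
  ultimately show "kxy.span (b ` ?K) \<subseteq> kxy.span (b ` {1..n}) \<inter> flag r j" by blast
qed

lemma jumps_below:
  assumes "i \<le> n" "0 < i \<longrightarrow> jump r n p i < j" "i < n \<longrightarrow> j \<le> jump r n p (i + 1)"
  shows "{k\<in>{1..n}. jump r n p k < j} = {1..i}"
proof -
  have "jump r n p k < j \<longleftrightarrow> k \<le> i" if k: "k \<in> {1..n}" for k
  proof
    assume "jump r n p k < j"
    then show "k \<le> i"
      using strict_mono_on_leD[OF jump_strict_mono _ k, of "i + 1"] assms(3) k by fastforce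
  next
    assume "k \<le> i"
    then show "jump r n p k < j"
      using strict_mono_on_leD[OF jump_strict_mono k, of i] assms(1,2) k by fastforce
  qed
  then show ?thesis using assms(1) by auto
qed

lemma echelon_span_in_cell:
  assumes b: "echelon b"
  shows "kxy.span (b ` {1..n}) \<in> schubert_cell r n p"
proof -
  have card: "kxy.dim (kxy.span (b ` K)) = card K" if "K \<subseteq> {1..n}" for K
  proof -
    have "kxy.independent (b ` K)"
      using echelon_independent[OF b] that by (rule kxy.independent_mono[OF _ image_mono])
    moreover have "inj_on b K" using echelon_inj[OF b] that by (rule inj_on_subset)
    ultimately show ?thesis by (simp add: kxy.dim_eq_card_independent card_image)
  qed
  have "kxy.span (b ` {1..n}) \<subseteq> homogeneous r"
    using echelonD(1)[OF b] subspace_homogeneous by (intro kxy.span_minimal) auto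
  then have "kxy.span (b ` {1..n}) \<in> grassmannian n r"
    using card[of "{1..n}"] by (simp add: grassmannian_def)
  moreover have "kxy.dim (kxy.span (b ` {1..n}) \<inter> flag r j) = i"
    if "i \<le> n" "j \<le> r + 1" "0 < i \<longrightarrow> jump r n p i < j" "i < n \<longrightarrow> j \<le> jump r n p (i + 1)" for i j
  proof -
    have "kxy.dim (kxy.span (b ` {1..n}) \<inter> flag r j) = card {k\<in>{1..n}. jump r n p k < j}"
      unfolding echelon_inter_flag[OF b that(2)] by (rule card) auto
    then show ?thesis using jumps_below[OF that(1,3,4)] by simp
  qed
  ultimately show ?thesis
    unfolding schubert_cell_iff by simp
qed

lemma echelon_ordered_basis:
  assumes b: "echelon b"
  shows "ordered_basis (map b [1..<Suc n]) (kxy.span (b ` {1..n}))"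
proof -
  have set: "set [1..<Suc n] = {1..n}" by auto
  show ?thesis
    unfolding ordered_basis_def distinct_map set_map set
    using echelon_inj[OF b] echelon_independent[OF b] by simp
qed

end

section \<open>Forms in the Pluecker coordinates along a one-parameter family\<close>

definition poly_fun :: "('k::field \<Rightarrow> 'k) \<Rightarrow> bool" where
  "poly_fun f \<longleftrightarrow> (\<exists>P. \<forall>x. f x = poly P x)"

lemma poly_fun_const: "poly_fun (\<lambda>x. c)"
  unfolding poly_fun_def by (rule exI[of _ "[:c:]"]) simp

lemma poly_fun_id: "poly_fun (\<lambda>x. x)"
  unfolding poly_fun_def by (rule exI[of _ "[:0, 1:]"]) simp

lemma poly_fun_add: "poly_fun f \<Longrightarrow> poly_fun g \<Longrightarrow> poly_fun (\<lambda>x. f x + g x)"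
  unfolding poly_fun_def by (metis poly_add)

lemma poly_fun_diff: "poly_fun f \<Longrightarrow> poly_fun g \<Longrightarrow> poly_fun (\<lambda>x. f x - g x)"
  unfolding poly_fun_def by (metis poly_diff)

lemma poly_fun_mult: "poly_fun f \<Longrightarrow> poly_fun g \<Longrightarrow> poly_fun (\<lambda>x. f x * g x)"
  unfolding poly_fun_def by (metis poly_mult)

lemma poly_fun_power: "poly_fun f \<Longrightarrow> poly_fun (\<lambda>x. f x ^ m)"
  unfolding poly_fun_def by (metis poly_power)

lemma poly_fun_sum: "(\<And>i. i \<in> A \<Longrightarrow> poly_fun (f i)) \<Longrightarrow> poly_fun (\<lambda>x. \<Sum>i\<in>A. f i x)"
  by (induction A rule: infinite_finite_induct) (simp_all add: poly_fun_const poly_fun_add)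

lemma poly_fun_prod: "(\<And>i. i \<in> A \<Longrightarrow> poly_fun (f i)) \<Longrightarrow> poly_fun (\<lambda>x. \<Prod>i\<in>A. f i x)"
  by (induction A rule: infinite_finite_induct) (simp_all add: poly_fun_const poly_fun_mult)

lemma poly_fun_finite_zeros:
  assumes "poly_fun f" and "f a \<noteq> 0"
  shows "finite {x. f x = 0}"
proof -
  obtain P where P: "\<And>x. f x = poly P x" using assms(1) by (auto simp: poly_fun_def)
  then have "P \<noteq> 0" using assms(2) by auto
  then show ?thesis unfolding P by (rule poly_roots_finite)
qed

lemma poly_fun_det:
  assumes "\<And>i j. i < n \<Longrightarrow> j < n \<Longrightarrow> poly_fun (g i j)"
  shows "poly_fun (\<lambda>x. Determinant.det (Matrix.mat n n (\<lambda>(i, j). g i j x)))"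
proof -
  have "Determinant.det (Matrix.mat n n (\<lambda>(i, j). g i j x)) =
      (\<Sum>\<sigma> | \<sigma> permutes {0..<n}. signof \<sigma> * (\<Prod>i = 0..<n. g i (\<sigma> i) x))" for x
  proof -
    have "Matrix.mat n n (\<lambda>(i, j). g i j x) $$ (i, \<sigma> i) = g i (\<sigma> i) x"
      if "\<sigma> permutes {0..<n}" "i \<in> {0..<n}" for \<sigma> i
      using that permutes_in_image[OF that(1), of i] by simp
    then show ?thesis
      by (subst det_def'[of _ n]) (auto intro!: sum.cong prod.cong)
  qed
  moreover have "poly_fun (\<lambda>x. \<Sum>\<sigma> | \<sigma> permutes {0..<n}. signof \<sigma> * (\<Prod>i = 0..<n. g i (\<sigma> i) x))"
    using assms by (intro poly_fun_sum poly_fun_mult poly_fun_const poly_fun_prod)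
      (auto dest: permutes_in_image)
  ultimately show ?thesis by simp
qed

lemma poly_fun_pluecker:
  assumes "\<And>a s. a < n \<Longrightarrow> poly_fun (\<lambda>x. coord r s (B x ! a))"
  shows "poly_fun (\<lambda>x. pluecker n r (B x) I)"
  unfolding pluecker_def Let_def
  by (rule poly_fun_det) (use assms in \<open>simp add: coord_def\<close>)

lemma poly_fun_mpol_eval:
  assumes "\<And>i. poly_fun (\<lambda>x. v x i)"
  shows "poly_fun (\<lambda>x. mpol_eval (v x) F)"
  unfolding mpol_eval_def
  by (intro poly_fun_sum poly_fun_mult poly_fun_const poly_fun_prod poly_fun_power assms)

lemma mpol_eval_homogeneous_scale:
  assumes F: "mpol_homogeneous X d F" and v: "\<And>i. i \<in> X \<Longrightarrow> v i = c * u i"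
  shows "mpol_eval v F = c ^ d * mpol_eval u F"
proof -
  have "(\<Prod>i\<in>Poly_Mapping.keys m. v i ^ Poly_Mapping.lookup m i)
      = c ^ d * (\<Prod>i\<in>Poly_Mapping.keys m. u i ^ Poly_Mapping.lookup m i)"
    if "m \<in> Poly_Mapping.keys F" for m
  proof -
    have m: "Poly_Mapping.keys m \<subseteq> X" "(\<Sum>i\<in>Poly_Mapping.keys m. Poly_Mapping.lookup m i) = d"
      using F that by (auto simp: mpol_homogeneous_def)
    have "(\<Prod>i\<in>Poly_Mapping.keys m. v i ^ Poly_Mapping.lookup m i)
        = (\<Prod>i\<in>Poly_Mapping.keys m. c ^ Poly_Mapping.lookup m i * u i ^ Poly_Mapping.lookup m i)"
      using m(1) v by (intro prod.cong) (auto simp: power_mult_distrib)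
    also have "\<dots> = c ^ d * (\<Prod>i\<in>Poly_Mapping.keys m. u i ^ Poly_Mapping.lookup m i)"
      by (simp add: prod.distrib m(2) flip: power_sum)
    finally show ?thesis .
  qed
  then show ?thesis
    unfolding mpol_eval_def sum_distrib_left
    by (intro sum.cong refl) (simp add: mult.left_commute)
qed

definition mpol_var :: "'i \<Rightarrow> ('i, 'k::field) mpol" where
  "mpol_var i = Poly_Mapping.single (Poly_Mapping.single i 1) 1"

lemma mpol_eval_var: "mpol_eval v (mpol_var i) = v i"
  by (simp add: mpol_eval_def mpol_var_def)

lemma mpol_homogeneous_var: "i \<in> X \<Longrightarrow> mpol_homogeneous X 1 (mpol_var i)"
  by (simp add: mpol_homogeneous_def mpol_var_def)

lemma infinite_alg_closed: "infinite (UNIV :: 'k::alg_closed_field set)"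
proof
  assume fin: "finite (UNIV :: 'k set)"
  define P where "P = (\<Prod>a\<in>(UNIV :: 'k set). [:- a, 1:]) + 1"
  have "poly P x = 1" for x
  proof -
    have "(\<Prod>a\<in>(UNIV :: 'k set). poly [:- a, 1:] x) = 0"
      using fin by (intro prod_zero bexI[of _ x]) auto
    then show ?thesis by (simp add: P_def poly_prod)
  qed
  moreover have "degree P > 0"
  proof -
    have "degree (\<Prod>a\<in>(UNIV :: 'k set). [:- a, 1:]) = card (UNIV :: 'k set)"
      by (subst degree_prod_eq_sum_degree) auto
    moreover have "card (UNIV :: 'k set) > 0" using fin by (simp add: card_gt_0_iff)
    ultimately show ?thesis unfolding P_def by (subst degree_add_eq_left) simp_all
  qed
  ultimately show False using alg_closed_imp_poly_has_root[of P] by auto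
qed

lemma openin_nonvanishing_locus:
  "mpol_homogeneous (pluecker_index n r) d F \<Longrightarrow>
    openin (zariski_grassmannian n r) (nonvanishing_locus n r F)"
  unfolding zariski_grassmannian_def by (rule topology_generated_by_Basis) blast

text \<open>
  A homogeneous form in the Pluecker coordinates becomes a polynomial in the parameter \<open>x\<close>, so it
  vanishes for finitely many \<open>x\<close> once it is nonzero at \<open>x = a\<close>. Cofiniteness is stable under the finite
  intersections and the unions that generate the topology from the nonvanishing loci. The
  assumption \<open>basis\<close> asks that the loci containing \<open>W a\<close> are detected by the basis \<open>B a\<close>, whereas
  \<open>nonvanishing_locus\<close> only provides some basis.
\<close>

lemma open_contains_almost_all_of_family:
  assumes W: "\<And>x. W x \<in> grassmannian n r" and B: "\<And>x. ordered_basis (B x) (W x)"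
    and poly: "\<And>a s. a < n \<Longrightarrow> poly_fun (\<lambda>x. coord r s (B x ! a))"
    and basis: "\<And>F d. mpol_homogeneous (pluecker_index n r) d F \<Longrightarrow>
      W a \<in> nonvanishing_locus n r F \<Longrightarrow> mpol_eval (pluecker n r (B a)) F \<noteq> 0"
    and U: "openin (zariski_grassmannian n r) U" "W a \<in> U"
  shows "finite {x. W x \<notin> U}"
proof -
  have "generate_topology_on {nonvanishing_locus n r F | F d. mpol_homogeneous (pluecker_index n r) d F} U"
    using U(1) unfolding zariski_grassmannian_def by (rule openin_topology_generated_by)
  then show ?thesis using U(2)
  proof (induction rule: generate_topology_on.induct)
    case Empty
    then show ?case by simp
  next
    case (Int U V)
    have "{x. W x \<notin> U \<inter> V} = {x. W x \<notin> U} \<union> {x. W x \<notin> V}" by auto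
    then show ?case using Int by simp
  next
    case (UN K)
    then obtain V where V: "V \<in> K" "W a \<in> V" by auto
    then have "finite {x. W x \<notin> V}" using UN by auto
    then show ?case by (rule finite_subset[rotated]) (use V(1) in auto)
  next
    case (Basis V)
    then obtain F d where F: "V = nonvanishing_locus n r F"
      "mpol_homogeneous (pluecker_index n r) d F" by blast
    define f where "f x = mpol_eval (pluecker n r (B x)) F" for x
    have "poly_fun f"
      unfolding f_def using poly by (intro poly_fun_mpol_eval poly_fun_pluecker)
    moreover have "f a \<noteq> 0" using basis[OF F(2)] Basis.prems by (simp add: f_def F(1))
    ultimately have "finite {x. f x = 0}" by (rule poly_fun_finite_zeros)
    moreover have "{x. W x \<notin> V} \<subseteq> {x. f x = 0}"
      using W B by (auto simp: F(1) nonvanishing_locus_def f_def)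
    ultimately show ?case by (rule finite_subset[rotated])
  qed
qed

text \<open>
  All Pluecker coordinates of the span of the monomials in \<open>T\<close> vanish except the one at \<open>T\<close>: for
  \<open>I \<noteq> T\<close> some monomial in \<open>T\<close> vanishes on \<open>I\<close>. So the Pluecker vectors of two bases are proportional,
  and homogeneity carries the nonvanishing of \<open>F\<close> from one basis to the other.
\<close>

lemma coordinate_subspace_nonvanishing:
  assumes W: "W \<in> grassmannian n r" and B: "ordered_basis B W"
    and T: "T \<in> pluecker_index n r"
    and mon: "\<And>t. t \<in> T \<Longrightarrow> Poly_Mapping.single (r - t, t) 1 \<in> W"
    and inj: "\<And>w. w \<in> W \<Longrightarrow> (\<And>t. t \<in> T \<Longrightarrow> coord r t w = 0) \<Longrightarrow> w = 0"
    and F: "mpol_homogeneous (pluecker_index n r) d F" and in_locus: "W \<in> nonvanishing_locus n r F"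
  shows "mpol_eval (pluecker n r B) F \<noteq> 0"
proof -
  have at_T: "pluecker n r B' T \<noteq> 0" if "ordered_basis B' W" for B'
    using pluecker_eq_0_iff[OF W that T] inj by blast
  have off_T: "pluecker n r B' I = 0"
    if B': "ordered_basis B' W" and I: "I \<in> pluecker_index n r" "I \<noteq> T" for B' I
  proof -
    have "finite I" "card T = card I" using T I finite_subset by (auto simp: pluecker_index_def)
    then obtain t where t: "t \<in> T" "t \<notin> I" using I(2) card_subset_eq[of I T] by blast
    let ?m = "Poly_Mapping.single (r - t, t) (1::'a)"
    have "coord r t ?m \<noteq> 0" by simp
    then have "?m \<noteq> 0" by (metis coord_0)
    moreover have "\<forall>s\<in>I. coord r s ?m = 0" using t by auto
    ultimately show ?thesis using pluecker_eq_0_iff[OF W B' I(1)] mon[OF t(1)] by blast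
  qed
  obtain B' where B': "ordered_basis B' W" "mpol_eval (pluecker n r B') F \<noteq> 0"
    using in_locus by (auto simp: nonvanishing_locus_def)
  define c where "c = pluecker n r B' T / pluecker n r B T"
  have "pluecker n r B' I = c * pluecker n r B I" if "I \<in> pluecker_index n r" for I
    using off_T[OF B'(1) that] off_T[OF B that] at_T[OF B] by (cases "I = T") (simp_all add: c_def)
  then have "mpol_eval (pluecker n r B') F = c ^ d * mpol_eval (pluecker n r B) F"
    by (rule mpol_eval_homogeneous_scale[OF F])
  then show ?thesis using B'(2) by auto
qed

section \<open>Comparing two sequences\<close>

locale sequence_pair =
  P: admissible_sequence r n p + Q: admissible_sequence r n q
  for r n :: nat and p q :: "nat \<Rightarrow> nat"
begin

abbreviation s where "s \<equiv> jump r n p"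
abbreviation t where "t \<equiv> jump r n q"

lemma entries_le_iff: "i \<in> {1..n} \<Longrightarrow> p i \<le> q i \<longleftrightarrow> t i \<le> s i"
  using P.jump_add[of i] Q.jump_add[of i] by linarith

lemma dominance_iff_shiftable:
  "(\<forall>i\<in>{1..n}. p i \<le> q i) \<longleftrightarrow> shiftable (t ` {1..n}) (s ` {1..n})"
  unfolding shiftable_strict_mono_images[OF P.jump_strict_mono Q.jump_strict_mono]
  using entries_le_iff by blast

text \<open>
  Let \<open>W\<close> be a common point and \<open>T\<close> the set of jumps of \<open>q\<close>. The Pluecker coordinate at \<open>T\<close> is
  nonzero at \<open>W\<close>, hence also at some \<open>V\<close> in the cell of \<open>p\<close>. Thus \<open>V\<close> projects injectively to the
  coordinates in \<open>T\<close>. The vectors of \<open>V\<close> with highest coordinate at most \<open>s i\<close> form a space of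
  dimension \<open>i\<close>, and such a vector is determined by its coordinates at the elements of \<open>T\<close> up to
  \<open>s i\<close>. So \<open>T\<close> has at least \<open>i\<close> of these.
\<close>

lemma closure_meets_cell_imp_dominance:
  assumes "(zariski_grassmannian n r closure_of schubert_cell r n p) \<inter>
      (schubert_cell r n q :: 'k::field kxy set set) \<noteq> {}"
    and i: "i \<in> {1..n}"
  shows "t i \<le> s i"
proof -
  let ?T = "t ` {1..n}"
  let ?F = "mpol_var ?T :: (nat set, 'k) mpol"
  obtain W :: "'k kxy set" where W: "W \<in> zariski_grassmannian n r closure_of schubert_cell r n p"
    "W \<in> schubert_cell r n q" using assms(1) by blast
  have grass: "W \<in> grassmannian n r" using W(2) by (simp add: Q.schubert_cell_iff)
  obtain B where B: "ordered_basis B W" using ordered_basis_exists[OF grass] .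
  have "W \<in> nonvanishing_locus n r ?F"
    using grass B Q.cell_pluecker_nonzero[OF W(2) B]
    by (auto simp: nonvanishing_locus_def mpol_eval_var)
  moreover have "openin (zariski_grassmannian n r) (nonvanishing_locus n r ?F)"
    using mpol_homogeneous_var[OF Q.jump_index] by (rule openin_nonvanishing_locus)
  ultimately obtain V where V: "V \<in> schubert_cell r n p" "V \<in> nonvanishing_locus n r ?F"
    using W(1) unfolding in_closure_of by blast
  then obtain C where C: "V \<in> grassmannian n r" "ordered_basis C V" "pluecker n r C ?T \<noteq> 0"
    by (auto simp: nonvanishing_locus_def mpol_eval_var)
  have inj: "w = 0" if "w \<in> V" "\<And>u. u \<in> ?T \<Longrightarrow> coord r u w = 0" for w
    using pluecker_eq_0_iff[OF C(1,2) Q.jump_index] C(3) that by blast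
  have V_sub: "kxy.subspace V" "V \<subseteq> homogeneous r" using C(1) by (auto simp: grassmannian_def)
  define J where "J = {u\<in>?T. u < Suc (s i)}"
  have le: "Suc (s i) \<le> r + 1" using P.jump_le[OF i] by simp
  have "kxy.dim (V \<inter> flag r (Suc (s i))) \<le> card J"
  proof (rule dim_le_card_coords)
    show "kxy.subspace (V \<inter> flag r (Suc (s i)))"
      using V_sub(1) by (auto simp: flag_def intro: kxy.subspace_inter)
    show "V \<inter> flag r (Suc (s i)) \<subseteq> homogeneous r" using V_sub(2) by blast
    show "finite J" by (simp add: J_def)
    fix w assume w: "w \<in> V \<inter> flag r (Suc (s i))" "\<And>u. u \<in> J \<Longrightarrow> coord r u w = 0"
    have "coord r u w = 0" if "u \<in> ?T" for u
    proof (cases "u < Suc (s i)")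
      case True
      then show ?thesis using w(2) that by (simp add: J_def)
    next
      case False
      moreover have "u \<le> r" using that Q.jumps_subset by auto
      ultimately show ?thesis using w(1) by (simp add: mem_flag_iff[OF le])
    qed
    then show "w = 0" using inj w(1) by blast
  qed
  then have "i \<le> card J" using P.cell_flag_dim[OF V(1) i] by simp
  then show ?thesis unfolding J_def by (rule strict_mono_on_le_of_count[OF Q.jump_strict_mono i])
qed

text \<open>
  Join the \<open>i\<close>-th monomial of \<open>q\<close> to the \<open>i\<close>-th monomial of \<open>p\<close> by a line. For every parameter
  \<open>x \<noteq> 0\<close> the pivots are the jumps of \<open>p\<close>, and at \<open>x = 0\<close> they degenerate to the jumps of \<open>q\<close>.
\<close>

lemma dominance_imp_closure_meets_cell:
  assumes le: "\<And>i. i \<in> {1..n} \<Longrightarrow> t i \<le> s i"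
  shows "(zariski_grassmannian n r closure_of schubert_cell r n p) \<inter>
      (schubert_cell r n q :: 'k::alg_closed_field kxy set set) \<noteq> {}"
proof -
  define mon :: "nat \<Rightarrow> 'k kxy" where "mon u = Poly_Mapping.single (r - u, u) 1" for u
  \<comment> \<open>The weight \<open>1 - x\<close> keeps \<open>b x i\<close> nonzero for all \<open>x\<close> when the two monomials coincide.\<close>
  define b where "b x i = kxy_scale (1 - x) (mon (t i)) + kxy_scale x (mon (s i))" for x i
  define W where "W x = kxy.span (b x ` {1..n})" for x
  define B where "B x = map (b x) [1..<Suc n]" for x
  have coord_b: "coord r u (b x i) = (if u = t i then 1 - x else 0) + (if u = s i then x else 0)" for u x i
    by (simp add: b_def mon_def)
  have hom: "b x i \<in> homogeneous r" if "i \<in> {1..n}" for x i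
    unfolding b_def mon_def using that P.jump_le Q.jump_le
    by (intro kxy.subspace_add[OF subspace_homogeneous] kxy.subspace_scale[OF subspace_homogeneous]
        monomial_homogeneous)
  have b0: "b 0 i = mon (t i)" for i by (simp add: b_def)
  have ech_p: "P.echelon (b x)" if "x \<noteq> 0" for x
    unfolding P.echelon_def
  proof (intro ballI conjI allI impI)
    fix i assume i: "i \<in> {1..n}"
    show "b x i \<in> homogeneous r" using hom[OF i] .
    show "coord r (s i) (b x i) \<noteq> 0" using that by (simp add: coord_b)
    show "coord r u (b x i) = 0" if "u \<le> r" "s i < u" for u using le[OF i] that by (simp add: coord_b)
  qed
  have ech_q: "Q.echelon (b 0)"
    unfolding Q.echelon_def using hom by (auto simp: coord_b)
  have cell_p: "W x \<in> schubert_cell r n p" if "x \<noteq> 0" for x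
    unfolding W_def using ech_p[OF that] by (rule P.echelon_span_in_cell)
  have cell_q: "W 0 \<in> schubert_cell r n q"
    unfolding W_def using ech_q by (rule Q.echelon_span_in_cell)
  have grass: "W x \<in> grassmannian n r" for x
    using cell_p cell_q by (cases "x = 0") (auto simp: P.schubert_cell_iff Q.schubert_cell_iff)
  have ord: "ordered_basis (B x) (W x)" for x
    unfolding B_def W_def
    using P.echelon_ordered_basis[OF ech_p] Q.echelon_ordered_basis[OF ech_q] by (cases "x = 0") auto
  have "poly_fun (\<lambda>x. coord r u (B x ! a))" if "a < n" for a u
  proof -
    have "coord r u (B x ! a) = (if u = t (Suc a) then 1 - x else 0) + (if u = s (Suc a) then x else 0)" for x
      using that by (simp add: B_def coord_b del: upt_Suc)
    moreover have "poly_fun (\<lambda>x::'k. (if c then 1 - x else 0) + (if d then x else 0))" for c d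
      by (cases c; cases d)
        (simp_all add: poly_fun_const poly_fun_id poly_fun_diff)
    ultimately show ?thesis by simp
  qed
  note poly = this
  have basis: "mpol_eval (pluecker n r (B 0)) F \<noteq> 0"
    if "mpol_homogeneous (pluecker_index n r) d F" "W 0 \<in> nonvanishing_locus n r F" for F d
  proof (rule coordinate_subspace_nonvanishing[OF grass ord Q.jump_index _ _ that])
    show "Poly_Mapping.single (r - u, u) 1 \<in> W 0" if "u \<in> t ` {1..n}" for u
      using that unfolding W_def by (auto simp: b0 mon_def intro!: kxy.span_base)
    show "w = 0" if "w \<in> W 0" "\<And>u. u \<in> t ` {1..n} \<Longrightarrow> coord r u w = 0" for w
      using Q.cell_vanishing_on_jumps[OF cell_q] that by blast
  qed
  have "W 0 \<in> zariski_grassmannian n r closure_of schubert_cell r n p"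
    unfolding in_closure_of
  proof (intro conjI allI impI)
    let ?F = "mpol_var (t ` {1..n}) :: (nat set, 'k) mpol"
    have "W 0 \<in> nonvanishing_locus n r ?F"
      using grass ord Q.cell_pluecker_nonzero[OF cell_q ord]
      by (auto simp: nonvanishing_locus_def mpol_eval_var)
    then show "W 0 \<in> topspace (zariski_grassmannian n r)"
      using openin_subset[OF openin_nonvanishing_locus[OF mpol_homogeneous_var[OF Q.jump_index]]]
      by blast
    fix U assume U: "W 0 \<in> U \<and> openin (zariski_grassmannian n r) U"
    have "finite {x. W x \<notin> U}"
    proof (rule open_contains_almost_all_of_family[OF grass ord])
      show "openin (zariski_grassmannian n r) U" "W 0 \<in> U" using U by auto
    qed (fact poly, fact basis)
    then have "finite (insert 0 {x. W x \<notin> U})" by simp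
    then obtain x where "x \<notin> insert 0 {x. W x \<notin> U}"
      using ex_new_if_finite[OF infinite_alg_closed] by blast
    then show "\<exists>V. V \<in> schubert_cell r n p \<and> V \<in> U" using cell_p by auto
  qed
  then show ?thesis using cell_q by blast
qed

lemma arrow_system_iff:
  "(\<exists>S. arrow_system (staircase_of r n p) S \<and> arrow_ends S = staircase_of r n q)
    \<longleftrightarrow> shiftable (t ` {1..n}) (s ` {1..n})"
proof -
  have "(\<exists>S. arrow_system (staircase_of r n p) S \<and> arrow_ends S = staircase_of r n q)
      \<longleftrightarrow> shiftable ({..r} - s ` {1..n}) ({..r} - t ` {1..n})"
    unfolding P.degree_slice_staircase_of[symmetric] Q.degree_slice_staircase_of[symmetric]
    by (rule arrow_system_iff_shiftable[OF P.staircase_staircase_of Q.staircase_staircase_of])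
       (auto simp: P.staircase_of_alt Q.staircase_of_alt)
  also have "\<dots> \<longleftrightarrow> shiftable (t ` {1..n}) (s ` {1..n})"
    by (rule shiftable_complement[OF _ P.jumps_subset Q.jumps_subset]) simp
  finally show ?thesis .
qed

text \<open>
  The top slice of a dual consists of reflected removed monomials. Reflecting back reverses the order,
  and so does the complement inside the box, which is the slice of the original staircase. Hence
  the two staircases and their duals pose the same comparison.
\<close>

lemma dual_arrow_system_iff:
  assumes box: "staircase_of r n p \<subseteq> box M N" "staircase_of r n q \<subseteq> box M N"
  shows "(\<exists>S. arrow_system (dual_staircase M N (staircase_of r n p)) S \<and>
       arrow_ends S = dual_staircase M N (staircase_of r n q))
    \<longleftrightarrow> shiftable (t ` {1..n}) (s ` {1..n})"
proof -
  \<comment> \<open>The exponents of \<open>y\<close> of the monomials of degree \<open>r\<close> inside the box. A monomial of degree \<open>r\<close>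
    outside the box is removed by both sequences, as the box contains both staircases.\<close>
  define X where "X = {u. u \<le> r \<and> u < N \<and> r - u < M}"
  have fin: "finite X" by (simp add: X_def)
  have sub: "P.box_jumps M N \<subseteq> X" "Q.box_jumps M N \<subseteq> X"
    using P.jumps_subset Q.jumps_subset by (auto simp: P.box_jumps_def Q.box_jumps_def X_def)
  have outside: "u \<in> s ` {1..n} \<and> u \<in> t ` {1..n}" if "u \<le> r" "u \<notin> X" for u
  proof -
    have "(r - u, u) \<notin> box M N" using that by (auto simp: X_def box_def)
    then have "(r - u, u) \<notin> staircase_of r n p" "(r - u, u) \<notin> staircase_of r n q"
      using box by auto
    then show ?thesis
      using that(1) unfolding P.staircase_of_alt Q.staircase_of_alt by (simp add: total_degree_def)
  qed
  have diff: "X - P.box_jumps M N = {..r} - s ` {1..n}" "X - Q.box_jumps M N = {..r} - t ` {1..n}"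
    using outside by (auto simp: X_def P.box_jumps_def Q.box_jumps_def)
  have below: "P.box_jumps M N \<subseteq> {..<N}" "Q.box_jumps M N \<subseteq> {..<N}"
    by (auto simp: P.box_jumps_def Q.box_jumps_def)
  have "(\<exists>S. arrow_system (dual_staircase M N (staircase_of r n p)) S \<and>
       arrow_ends S = dual_staircase M N (staircase_of r n q))
      \<longleftrightarrow> shiftable ((\<lambda>u. N - 1 - u) ` P.box_jumps M N) ((\<lambda>u. N - 1 - u) ` Q.box_jumps M N)"
    unfolding P.degree_slice_dual[symmetric] Q.degree_slice_dual[symmetric]
    by (rule arrow_system_iff_shiftable[OF P.staircase_dual Q.staircase_dual])
       (auto simp: P.mem_dual_iff Q.mem_dual_iff)
  also have "\<dots> \<longleftrightarrow> shiftable (Q.box_jumps M N) (P.box_jumps M N)"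
    by (rule shiftable_reflect[OF below(2,1)])
  also have "\<dots> \<longleftrightarrow> shiftable ({..r} - s ` {1..n}) ({..r} - t ` {1..n})"
    unfolding diff[symmetric] by (rule shiftable_complement[OF fin sub, symmetric])
  also have "\<dots> \<longleftrightarrow> shiftable (t ` {1..n}) (s ` {1..n})"
    by (rule shiftable_complement[OF _ P.jumps_subset Q.jumps_subset]) simp
  finally show ?thesis .
qed

end

theorem proposition21:
  fixes r n M N :: nat and p q :: "nat \<Rightarrow> nat"
  assumes "1 \<le> n" and "n \<le> r + 1"
    and "antimono_on {1..n} p" and "p 1 \<le> r + 1 - n"
    and "antimono_on {1..n} q" and "q 1 \<le> r + 1 - n"
    and "staircase_of r n p \<subseteq> box M N" and "staircase_of r n q \<subseteq> box M N"
  shows "((zariski_grassmannian n r closure_of schubert_cell r n p) \<inter>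
            (schubert_cell r n q :: 'k::alg_closed_field kxy set set) \<noteq> {}
          \<longleftrightarrow> (\<forall>i\<in>{1..n}. q i \<ge> p i)) \<and>
         ((\<forall>i\<in>{1..n}. q i \<ge> p i)
          \<longleftrightarrow> (\<exists>S. arrow_system (staircase_of r n p) S \<and>
                 arrow_ends S = staircase_of r n q)) \<and>
         ((\<exists>S. arrow_system (staircase_of r n p) S \<and>
             arrow_ends S = staircase_of r n q)
          \<longleftrightarrow> (\<exists>S. arrow_system (dual_staircase M N (staircase_of r n p)) S \<and>
                 arrow_ends S = dual_staircase M N (staircase_of r n q)))"
proof -
  interpret sequence_pair r n p q
    by unfold_locales (fact assms)+
  have "(zariski_grassmannian n r closure_of schubert_cell r n p) \<inter>
      (schubert_cell r n q :: 'k kxy set set) \<noteq> {} \<longleftrightarrow> (\<forall>i\<in>{1..n}. p i \<le> q i)"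
    using closure_meets_cell_imp_dominance dominance_imp_closure_meets_cell entries_le_iff by blast
  then show ?thesis
    using dominance_iff_shiftable arrow_system_iff dual_arrow_system_iff[OF assms(7,8)] by blast
qed

end
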